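(* Let $G$ be a $2$-connected graph which is not a cycle. If $G$ is $\{K_{1,3},P_4\}$-$f_1$-heavy, then $G$ is pancyclic.
   Context: All graphs are finite and simple. Let $G$ be a graph on $n$ vertices, and $d(x)$ the degree of $x$ in $G$. For a subgraph $H$ and $x,y\in V(H)$, $d_H(x,y)$ is the length of a shortest $(x,y)$-path in $H$. An induced subgraph $H$ of $G$ is called $f_1$-heavy if for every pair of vertices $u,v\in V(H)$ with $d_H(u,v)=2$ we have $\max\{d(u),d(v)\}\geq (n+1)/2$ (degrees taken in $G$). For a graph $R$, $G$ is $R$-$f_1$-heavy if every induced subgraph of $G$ isomorphic to $R$ is $f_1$-heavy; for a family $\mathcal{R}$ of graphs, $G$ is $\mathcal{R}$-$f_1$-heavy if it is $R$-$f_1$-heavy for every $R\in\mathcal{R}$. $K_{1,3}$ is the claw and $P_4$ is the path on 4 vertices. A graph on $n$ vertices is pancyclic if it contains cycles of every length from $3$ to $n$. *)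

theory Defs
  imports Complex_Main
begin

definition graph :: "'a set \<Rightarrow> ('a \<Rightarrow> 'a \<Rightarrow> bool) \<Rightarrow> bool" where
  "graph V E \<longleftrightarrow> finite V \<and> (\<forall>x y. E x y \<longrightarrow> x \<in> V \<and> y \<in> V)
     \<and> (\<forall>x y. E x y \<longrightarrow> E y x) \<and> (\<forall>x. \<not> E x x)"

definition degree :: "'a set \<Rightarrow> ('a \<Rightarrow> 'a \<Rightarrow> bool) \<Rightarrow> 'a \<Rightarrow> nat" where
  "degree V E x = card {y \<in> V. E x y}"

definition walk_in :: "'a set \<Rightarrow> ('a \<Rightarrow> 'a \<Rightarrow> bool) \<Rightarrow> 'a list \<Rightarrow> bool" where
  "walk_in S E xs \<longleftrightarrow> xs \<noteq> [] \<and> set xs \<subseteq> S \<and> (\<forall>i. Suc i < length xs \<longrightarrow> E (xs ! i) (xs ! Suc i))"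

definition path_in :: "'a set \<Rightarrow> ('a \<Rightarrow> 'a \<Rightarrow> bool) \<Rightarrow> 'a \<Rightarrow> 'a \<Rightarrow> nat \<Rightarrow> bool" where
  "path_in S E u v k \<longleftrightarrow> (\<exists>xs. walk_in S E xs \<and> distinct xs \<and> hd xs = u \<and> last xs = v \<and> length xs = Suc k)"

definition dist_is :: "'a set \<Rightarrow> ('a \<Rightarrow> 'a \<Rightarrow> bool) \<Rightarrow> 'a \<Rightarrow> 'a \<Rightarrow> nat \<Rightarrow> bool" where
  "dist_is S E u v k \<longleftrightarrow> path_in S E u v k \<and> (\<forall>j<k. \<not> path_in S E u v j)"

definition induced_iso :: "'a set \<Rightarrow> ('a \<Rightarrow> 'a \<Rightarrow> bool) \<Rightarrow> 'a set
     \<Rightarrow> 'b set \<Rightarrow> ('b \<Rightarrow> 'b \<Rightarrow> bool) \<Rightarrow> bool" where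
  "induced_iso V E S RV RE \<longleftrightarrow> S \<subseteq> V \<and>
     (\<exists>f. bij_betw f RV S \<and> (\<forall>a\<in>RV. \<forall>b\<in>RV. E (f a) (f b) \<longleftrightarrow> RE a b))"

definition f1_heavy_set :: "'a set \<Rightarrow> ('a \<Rightarrow> 'a \<Rightarrow> bool) \<Rightarrow> 'a set \<Rightarrow> bool" where
  "f1_heavy_set V E S \<longleftrightarrow> (\<forall>u\<in>S. \<forall>v\<in>S. dist_is S E u v 2 \<longrightarrow>
      real (max (degree V E u) (degree V E v)) \<ge> (real (card V) + 1) / 2)"

definition R_f1_heavy :: "'a set \<Rightarrow> ('a \<Rightarrow> 'a \<Rightarrow> bool) \<Rightarrow> 'b set \<Rightarrow> ('b \<Rightarrow> 'b \<Rightarrow> bool) \<Rightarrow> bool" where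
  "R_f1_heavy V E RV RE \<longleftrightarrow> (\<forall>S. induced_iso V E S RV RE \<longrightarrow> f1_heavy_set V E S)"

definition claw_V :: "nat set" where "claw_V = {0,1,2,3}"
definition claw_E :: "nat \<Rightarrow> nat \<Rightarrow> bool" where
  "claw_E a b \<longleftrightarrow> a \<in> claw_V \<and> b \<in> claw_V \<and> a \<noteq> b \<and> (a = 0 \<or> b = 0)"
definition P4_V :: "nat set" where "P4_V = {0,1,2,3}"
definition P4_E :: "nat \<Rightarrow> nat \<Rightarrow> bool" where
  "P4_E a b \<longleftrightarrow> a \<in> P4_V \<and> b \<in> P4_V \<and> (a = b + 1 \<or> b = a + 1)"

definition connected :: "'a set \<Rightarrow> ('a \<Rightarrow> 'a \<Rightarrow> bool) \<Rightarrow> bool" where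
  "connected V E \<longleftrightarrow> (\<forall>u\<in>V. \<forall>v\<in>V. \<exists>xs. walk_in V E xs \<and> hd xs = u \<and> last xs = v)"

definition two_connected :: "'a set \<Rightarrow> ('a \<Rightarrow> 'a \<Rightarrow> bool) \<Rightarrow> bool" where
  "two_connected V E \<longleftrightarrow> card V \<ge> 3 \<and> connected V E \<and> (\<forall>x\<in>V. connected (V - {x}) E)"

definition is_cycle :: "'a set \<Rightarrow> ('a \<Rightarrow> 'a \<Rightarrow> bool) \<Rightarrow> 'a list \<Rightarrow> bool" where
  "is_cycle V E xs \<longleftrightarrow> length xs \<ge> 3 \<and> distinct xs \<and> walk_in V E xs \<and> E (last xs) (hd xs)"

definition cycle_edge :: "'a list \<Rightarrow> 'a \<Rightarrow> 'a \<Rightarrow> bool" where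
  "cycle_edge xs x y \<longleftrightarrow> (\<exists>i<length xs. {x, y} = {xs ! i, xs ! ((i + 1) mod length xs)})"

definition is_cycle_graph :: "'a set \<Rightarrow> ('a \<Rightarrow> 'a \<Rightarrow> bool) \<Rightarrow> bool" where
  "is_cycle_graph V E \<longleftrightarrow> (\<exists>xs. is_cycle V E xs \<and> set xs = V \<and> (\<forall>x y. E x y \<longrightarrow> cycle_edge xs x y))"

definition pancyclic :: "'a set \<Rightarrow> ('a \<Rightarrow> 'a \<Rightarrow> bool) \<Rightarrow> bool" where
  "pancyclic V E \<longleftrightarrow> (\<forall>k. 3 \<le> k \<and> k \<le> card V \<longrightarrow> (\<exists>xs. is_cycle V E xs \<and> length xs = k))"

end

theory Submission
  imports Defs
begin

text \<open>Call a vertex heavy if its degree is at least \<open>(n + 1) / 2\<close> and light otherwise.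

  Hamiltonicity: degree-sum closure on the heavy vertices gives a cycle through all of them. In a longest such
  cycle, an attachment \<open>x\<close> of an outside vertex can be moved past a light successor \<open>v\<close> (claw and \<open>P4\<close> at
  \<open>x\<close> supply the two edges needed), so both ends of an ear may be assumed to have heavy successors; these are
  the ends of a path covering cycle and ear, which closes up to a longer cycle.

  Pancyclicity: a Hamilton cycle with consecutive degrees summing to at least \<open>n + 1\<close> yields all lengths.
  Otherwise no Hamilton cycle has two consecutive heavy vertices. Then either two light vertices with a common
  neighbour dominate the graph, which forces \<open>C4\<close>, or adjacency is transitive on the light vertices and
  each heavy vertex with neighbours in two light classes is traversed from one class to the other. Rerouting shows
  that two classes share at most one such vertex, that each class has exactly two partner classes, and,
  counting common neighbours, that there are three classes in all: the graph is a 3-sun with its ears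
  blown up to cliques, which is pancyclic.\<close>

section \<open>Cycles and large degree sums\<close>

text \<open>The obstacle is that heavy vertices may be separated by light ones on every Hamilton
  cycle. The 3-sun shows this: n = 6, and its degrees 4 and 2 alternate along its only Hamilton
  cycle, so consecutive degrees sum to n and never to n + 1. Degree sums alone therefore cannot
  finish, and the structure has to be determined. The two bounds play different roles: a degree sum
  of n is enough to close a path, while the surplus of 1 is what yields all lengths, as the balanced
  complete bipartite graphs have all degree sums n and no odd cycle. Among cycles only C4 meets both
  heaviness conditions without being pancyclic, since a longer cycle contains an induced path on 4
  vertices whose vertices are all light; so C4 is the exception to isolate.\<close>

lemma walk_in_iff: "walk_in S E xs \<longleftrightarrow> xs \<noteq> [] \<and> set xs \<subseteq> S \<and> successively E xs"
  by (auto simp: walk_in_def successively_conv_nth)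

lemma is_cycle_iff:
  "is_cycle V E xs \<longleftrightarrow> 3 \<le> length xs \<and> distinct xs \<and> set xs \<subseteq> V \<and> successively E xs \<and> E (last xs) (hd xs)"
  by (auto simp: is_cycle_def walk_in_iff)

lemma is_cycle_append_commute: "is_cycle V E (xs @ ys) \<longleftrightarrow> is_cycle V E (ys @ xs)"
  by (cases "xs = []"; cases "ys = []") (auto simp: is_cycle_iff successively_append_iff)

lemma is_cycle_rotate1: "is_cycle V E (x # xs) \<Longrightarrow> is_cycle V E (xs @ [x])"
  using is_cycle_append_commute[of V E "[x]" xs] by simp

text \<open>In a shortest walk from \<open>a\<close> into \<open>B\<close>, a repeated vertex could
  be cut out, and an earlier vertex of \<open>B\<close> would be an earlier end. This serves both to
  obtain paths and to stop at the first contact with a cycle.\<close>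

lemma shortest_walk:
  assumes "walk_in S E xs" "hd xs = a" "last xs \<in> B"
  obtains ys where "walk_in S E ys" "hd ys = a" "last ys \<in> B" "distinct ys" "set (butlast ys) \<inter> B = {}"
proof -
  define W where "W = {ys. walk_in S E ys \<and> hd ys = a \<and> last ys \<in> B}"
  define ys where "ys = arg_min length (\<lambda>ys. ys \<in> W)"
  have ysW: "ys \<in> W"
    unfolding ys_def by (rule arg_min_natI[of _ xs]) (use assms in \<open>simp add: W_def\<close>)
  have least: "length ys \<le> length zs" if "zs \<in> W" for zs
    unfolding ys_def by (rule arg_min_nat_le) (use that in simp)
  have "distinct ys"
  proof (rule ccontr)
    assume "\<not> distinct ys"
    then obtain as y bs cs where eq: "ys = as @ [y] @ bs @ [y] @ cs"
      using not_distinct_decomp by blast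
    have "as @ [y] @ cs \<in> W"
      using ysW by (cases "as = []"; cases "cs = []")
        (auto simp: W_def eq walk_in_iff successively_append_iff successively_Cons hd_append)
    from least[OF this] show False by (simp add: eq)
  qed
  moreover have "set (butlast ys) \<inter> B = {}"
  proof (rule ccontr)
    assume "set (butlast ys) \<inter> B \<noteq> {}"
    then obtain b where b: "b \<in> set (butlast ys)" "b \<in> B" by blast
    then obtain as bs where eq: "butlast ys = as @ b # bs" by (meson split_list)
    have "ys \<noteq> []" using ysW by (auto simp: W_def walk_in_iff)
    then have ys: "ys = (as @ [b]) @ bs @ [last ys]"
      using append_butlast_last_id[of ys] eq by simp
    have "as @ [b] \<in> W"
      using ysW b by (subst (asm) ys, cases "as = []")
        (auto simp: W_def walk_in_iff successively_append_iff hd_append)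
    from least[OF this] have "length ys \<le> length (as @ [b])" .
    then show False by (subst (asm) ys) simp
  qed
  ultimately show ?thesis using that ysW by (auto simp: W_def)
qed

locale sgraph =
  fixes V :: "'a set" and E :: "'a \<Rightarrow> 'a \<Rightarrow> bool"
  assumes fin [simp]: "finite V"
    and E_V: "E x y \<Longrightarrow> x \<in> V \<and> y \<in> V"
    and E_sym: "E x y \<Longrightarrow> E y x"
    and E_irrefl [simp]: "\<not> E x x"
begin

lemma E_neq: "E x y \<Longrightarrow> x \<noteq> y"
  using E_irrefl by blast

lemma successively_rev_iff [simp]: "successively (\<lambda>x y. E y x) xs \<longleftrightarrow> successively E xs"
proof -
  have "(\<lambda>x y. E y x) = E" using E_sym by blast
  then show ?thesis by (rule arg_cong)
qed

lemma is_cycle_rev: "is_cycle V E xs \<Longrightarrow> is_cycle V E (rev xs)"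
  by (auto simp: is_cycle_iff hd_rev last_rev intro: E_sym)

abbreviation d where "d x \<equiv> degree V E x"

lemma degree_eq: "d x = card {y. E x y}"
  unfolding degree_def by (rule arg_cong[of _ _ card]) (use E_V in blast)

lemma finite_nbrs [simp]: "finite {y. E x y}" "finite {y. E x y \<and> P y}"
  by (rule finite_subset[of _ V], use E_V in auto)+

lemma cycle_length_le: "is_cycle V E xs \<Longrightarrow> length xs \<le> card V"
  unfolding is_cycle_iff by (metis card_mono distinct_card fin)

text \<open>On \<open>x # zs @ [y]\<close> an edge from \<open>x\<close> to position \<open>i\<close> of \<open>zs\<close> and an edge from \<open>y\<close> to position
  \<open>i + k - 3\<close>, taken cyclically, close a cycle of length \<open>k\<close>.\<close>
lemma pancyclic_if_large_degree_sum:
  assumes cyc: "is_cycle V E (x # zs @ [y])" and len: "length (x # zs @ [y]) = card V"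
    and deg: "d x + d y \<ge> card V + 1"
  shows "pancyclic V E"
  unfolding pancyclic_def
proof (intro allI impI)
  fix k assume k: "3 \<le> k \<and> k \<le> card V"
  define N where "N = length zs"
  have N: "card V = N + 2" using len by (simp add: N_def)
  define m where "m = k - 3"
  have m: "m < N" "k = m + 3" using k N by (auto simp: m_def)
  have cyc': "distinct zs" "x \<notin> set zs" "y \<notin> set zs" "x \<noteq> y" "set zs \<subseteq> V" "x \<in> V" "y \<in> V" "successively E zs"
    "E y x" "zs \<noteq> []" "E x (hd zs)" "E (last zs) y"
    using cyc by (auto simp: is_cycle_iff successively_Cons successively_append_iff hd_append split: if_splits)
  have setV: "set (x # zs @ [y]) = V"
    by (rule card_subset_eq) (use cyc len in \<open>auto simp: is_cycle_iff distinct_card simp del: set_append\<close>)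
  have nth: "zs ! i \<in> V" if "i < N" for i using that cyc'(5) by (auto simp: N_def)
  define I where "I = {i. i < N \<and> E x (zs ! i)}"
  define J where "J = {i. i < N \<and> E y (zs ! i)}"
  have card_idx: "card {i. i < N \<and> E a (zs ! i)} = card {v \<in> set zs. E a v}" for a
  proof -
    have "bij_betw ((!) zs) {i. i < N \<and> E a (zs ! i)} {v \<in> set zs. E a v}"
      using cyc'(1) unfolding bij_betw_def
      by (auto simp: N_def inj_on_def nth_eq_iff_index_eq in_set_conv_nth)
    then show ?thesis by (rule bij_betw_same_card)
  qed
  have dx: "d x = card I + 1"
  proof -
    have "{v. E x v} = insert y {v \<in> set zs. E x v}"
      using setV E_V[of x] cyc'(9) E_sym by (auto dest: E_neq)
    then show ?thesis unfolding degree_eq I_def card_idx using cyc' by simp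
  qed
  have dy: "d y = card J + 1"
  proof -
    have "{v. E y v} = insert x {v \<in> set zs. E y v}"
      using setV E_V[of y] cyc'(9) by (auto dest: E_neq)
    then show ?thesis unfolding degree_eq J_def card_idx using cyc' by simp
  qed
  define f where "f i = (i + m) mod N" for i
  have inj: "inj_on f I"
  proof (rule inj_onI)
    fix i j assume ij: "i \<in> I" "j \<in> I" "f i = f j"
    then have lt: "i < N" "j < N" by (auto simp: I_def)
    have f: "f a = (if a + m < N then a + m else a + m - N)" if "a < N" for a
      using that m by (auto simp: f_def mod_if)
    show "i = j" using ij(3) lt m unfolding f[OF lt(1)] f[OF lt(2)] by (auto split: if_splits)
  qed
  \<comment> \<open>Pigeonhole: \<open>I\<close> and \<open>J\<close> have together d x + d y - 2 >=
    N + 1 elements, so the shifted copy of \<open>I\<close> meets \<open>J\<close> among the N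
    positions.\<close>
  have "\<exists>i\<in>I. f i \<in> J"
  proof (rule ccontr)
    assume "\<not> ?thesis"
    then have disj: "f ` I \<inter> J = {}" by blast
    have "finite I" "finite J" by (auto simp: I_def J_def)
    then have "card I + card J = card (f ` I \<union> J)"
      using disj inj by (simp add: card_Un_disjoint card_image)
    also have "\<dots> \<le> card {..<N}"
      by (rule card_mono) (use m in \<open>auto simp: f_def J_def\<close>)
    finally show False using dx dy deg N by simp
  qed
  then obtain i where i: "i < N" "E x (zs ! i)" "f i < N" "E y (zs ! f i)"
    by (auto simp: I_def J_def)
  show "\<exists>xs. is_cycle V E xs \<and> length xs = k"
  proof (cases "i + m < N")
    case True
    define T where "T = take (m + 1) (drop i zs)"
    have fi: "f i = i + m" using True by (simp add: f_def)
    have split: "zs = take i zs @ T @ drop (m + 1) (drop i zs)"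
      by (simp add: T_def flip: append_assoc)
        (metis append_assoc append_take_drop_id drop_drop add.commute add_Suc_right plus_1_eq_Suc)
    have lenT: "length T = m + 1" using True by (simp add: T_def N_def)
    have T: "hd T = zs ! i" "last T = zs ! (i + m)" "T \<noteq> []"
      using True lenT by (auto simp: T_def N_def hd_conv_nth last_conv_nth)
    have sT: "successively E T"
      using cyc'(8) by (subst (asm) split) (auto simp: successively_append_iff)
    have dT: "distinct T" "set T \<subseteq> set zs"
      by (auto simp: T_def cyc' dest: in_set_takeD in_set_dropD)
    have "is_cycle V E (x # T @ [y])"
      unfolding is_cycle_iff using lenT T sT dT cyc' i fi
      by (auto simp: successively_Cons successively_append_iff intro: E_sym)
    then show ?thesis using lenT m by (intro exI[of _ "x # T @ [y]"]) simp
  next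
    case False
    \<comment> \<open>The shift wraps around. The cycle takes \<open>x\<close>, the first j + 1
      vertices of \<open>zs\<close>, \<open>y\<close>, and the last N - i vertices backwards, which
      are 1 + (j + 1) + 1 + (N - i) = m + 3 vertices.\<close>
    define j where "j = i + m - N"
    have fi: "f i = j" using False m i by (simp add: f_def j_def mod_if)
    have ji: "j < i" using m False by (auto simp: j_def)
    define A where "A = take (j + 1) zs"
    define B where "B = drop i zs"
    have lens: "length A = j + 1" "length B = N - i" using ji i by (auto simp: A_def B_def N_def)
    have "A \<noteq> []" using lens by auto
    then have A: "A \<noteq> []" "hd A = hd zs" "last A = zs ! j"
      using lens by (simp, simp add: A_def, simp add: last_conv_nth, simp add: A_def)
    have B: "B \<noteq> []" "hd B = zs ! i" "last B = last zs"
      using lens ji i by (auto simp: B_def N_def hd_drop_conv_nth)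
    have split: "zs = A @ drop (j + 1) zs" "zs = take i zs @ B" by (auto simp: A_def B_def)
    have s: "successively E A" "successively E B"
      using cyc'(8) split by (metis successively_append_iff)+
    have ds: "distinct A" "distinct B" "set A \<subseteq> set zs" "set B \<subseteq> set zs"
      by (auto simp: A_def B_def cyc' dest: in_set_takeD in_set_dropD)
    have AB: "set A \<inter> set B = {}"
      using set_take_disj_set_drop_if_distinct[OF cyc'(1), of "j+1" i] ji by (simp add: A_def B_def)
    have "is_cycle V E (x # A @ y # rev B)"
      unfolding is_cycle_iff using lens A B s ds AB cyc' i fi
      by (auto simp: successively_Cons successively_append_iff hd_rev last_rev intro: E_sym)
    moreover have "length (x # A @ y # rev B) = k" using lens m False i by (simp add: j_def)
    ultimately show ?thesis by blast
  qed
qed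

end

section \<open>Closure and cycles through all heavy vertices\<close>

context sgraph
begin

lemma card_common_nbrs: "d x + d y \<le> card V + card {c. E x c \<and> E y c}"
proof -
  have "card ({c. E x c} \<union> {c. E y c}) \<le> card V"
    by (rule card_mono) (use E_V in auto)
  then show ?thesis
    using card_Un_Int[of "{c. E x c}" "{c. E y c}"] by (simp add: degree_eq Collect_conj_eq)
qed

text \<open>Neither vertex lies in the union of the two neighbourhoods, which gains 2 over
  \<open>card_common_nbrs\<close>: two nonadjacent heavy vertices have at least three common
  neighbours.\<close>

lemma card_common_nbrs_nonadjacent:
  assumes "x \<noteq> y" "\<not> E x y" "x \<in> V" "y \<in> V"
  shows "d x + d y + 2 \<le> card V + card {c. E x c \<and> E y c}"
proof -
  have "card ({c. E x c} \<union> {c. E y c}) \<le> card (V - {x, y})"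
    by (rule card_mono) (use E_V E_sym assms in auto)
  moreover have "card (V - {x, y}) + 2 = card V"
    using assms card_mono[of V "{x, y}"] by (simp add: card_Diff_subset)
  ultimately show ?thesis
    using card_Un_Int[of "{c. E x c}" "{c. E y c}"] by (simp add: degree_eq Collect_conj_eq)
qed

text \<open>Ore's crossing chords for a path that need not span. If the ends are nonadjacent and
  have no common neighbour off the path, their neighbours off the path are disjoint, which leaves at
  least \<open>length p\<close> edges from the ends into the path. Pigeonhole on the
  \<open>length p - 1\<close> steps of the path then gives a step whose first vertex is adjacent to
  \<open>last p\<close> and whose second is adjacent to \<open>hd p\<close>.\<close>

lemma close_path:
  assumes p: "distinct p" "successively E p" "set p \<subseteq> V" "3 \<le> length p"
    and deg: "card V \<le> d (hd p) + d (last p)"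
  obtains c where "is_cycle V E c" "set p \<subseteq> set c"
proof -
  define u where "u = hd p"
  define v where "v = last p"
  define m where "m = length p"
  have ne: "p \<noteq> []" using p by auto
  have uv: "u \<in> set p" "v \<in> set p" using ne by (auto simp: u_def v_def)
  have u0: "u = p ! 0" "v = p ! (m - 1)" using ne by (auto simp: u_def v_def hd_conv_nth last_conv_nth m_def)
  consider (adj) "E v u" | (out) c where "c \<notin> set p" "E u c" "E v c"
    | (no) "\<not> E v u" "\<And>c. c \<notin> set p \<Longrightarrow> \<not> (E u c \<and> E v c)"
    by blast
  then show ?thesis
  proof cases
    case adj
    then have "is_cycle V E p" using p by (simp add: is_cycle_iff u_def v_def)
    then show ?thesis using that by blast
  next
    case out
    then have "is_cycle V E (c # p)" using p ne E_V E_sym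
      by (auto simp: is_cycle_iff successively_Cons u_def v_def)
    then show ?thesis using that[of "c # p"] by auto
  next
    case no
    define I where "I = {i. i < m - 1 \<and> E u (p ! Suc i)}"
    define J where "J = {i. i < m - 1 \<and> E v (p ! i)}"
    have cI: "card I = card {y \<in> set p. E u y}"
    proof (rule bij_betw_same_card)
      show "bij_betw (\<lambda>i. p ! Suc i) I {y \<in> set p. E u y}"
        unfolding bij_betw_def
      proof
        show "inj_on (\<lambda>i. p ! Suc i) I" using p(1) by (auto simp: inj_on_def I_def m_def nth_eq_iff_index_eq)
        have "y \<in> (\<lambda>i. p ! Suc i) ` I" if "y \<in> set p" "E u y" for y
        proof -
          obtain i where i: "i < m" "y = p ! i" using \<open>y \<in> set p\<close> unfolding in_set_conv_nth m_def by blast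
          moreover have "i \<noteq> 0" using that i u0 by (metis E_irrefl)
          ultimately show ?thesis using that by (intro image_eqI[of _ _ "i - 1"]) (auto simp: I_def)
        qed
        then show "(\<lambda>i. p ! Suc i) ` I = {y \<in> set p. E u y}" by (auto simp: I_def m_def)
      qed
    qed
    have cJ: "card J = card {y \<in> set p. E v y}"
    proof (rule bij_betw_same_card)
      show "bij_betw (\<lambda>i. p ! i) J {y \<in> set p. E v y}"
        unfolding bij_betw_def
      proof
        show "inj_on (\<lambda>i. p ! i) J" using p(1) by (auto simp: inj_on_def J_def m_def nth_eq_iff_index_eq)
        have "y \<in> (\<lambda>i. p ! i) ` J" if "y \<in> set p" "E v y" for y
        proof -
          obtain i where i: "i < m" "y = p ! i" using \<open>y \<in> set p\<close> unfolding in_set_conv_nth m_def by blast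
          moreover have "i \<noteq> m - 1" using that i u0 by (metis E_irrefl)
          ultimately show ?thesis using that by (intro image_eqI[of _ _ i]) (auto simp: J_def)
        qed
        then show "(\<lambda>i. p ! i) ` J = {y \<in> set p. E v y}" by (auto simp: J_def m_def)
      qed
    qed
    define Nu where "Nu = {y. E u y} - set p"
    define Nv where "Nv = {y. E v y} - set p"
    have spl: "d x = card {y \<in> set p. E x y} + card ({y. E x y} - set p)" for x
    proof -
      have "{y. E x y} = {y \<in> set p. E x y} \<union> ({y. E x y} - set p)" by auto
      then show ?thesis unfolding degree_eq
        by (subst card_Un_disjoint[symmetric]) (auto simp: Int_def)
    qed
    have du: "d u = card I + card Nu" and dv: "d v = card J + card Nv"
      unfolding Nu_def Nv_def cI cJ by (rule spl)+
    have "card (Nu \<union> Nv) \<le> card (V - set p)"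
      by (rule card_mono) (use E_V in \<open>auto simp: Nu_def Nv_def\<close>)
    moreover have "card (Nu \<union> Nv) = card Nu + card Nv"
      by (rule card_Un_disjoint) (use no in \<open>auto simp: Nu_def Nv_def\<close>)
    moreover have "card (V - set p) + m = card V"
      using p by (simp add: card_Diff_subset m_def distinct_card card_mono flip: distinct_card)
    ultimately have ij: "card I + card J \<ge> m"
      using deg du dv by (simp add: u_def v_def)
    have "I \<inter> J \<noteq> {}"
    proof
      assume disj: "I \<inter> J = {}"
      have "card I + card J = card (I \<union> J)"
        using disj by (simp add: card_Un_disjoint I_def J_def)
      also have "\<dots> \<le> card {..<m - 1}" by (rule card_mono) (auto simp: I_def J_def)
      finally show False using ij p by (simp add: m_def)
    qed
    then obtain i where i: "i < m - 1" "E u (p ! Suc i)" "E v (p ! i)" by (auto simp: I_def J_def)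
    define A where "A = take (Suc i) p"
    define B where "B = drop (Suc i) p"
    have pAB: "p = A @ B" by (simp add: A_def B_def)
    have lens: "length A = Suc i" "length B = m - Suc i" using i by (auto simp: A_def B_def m_def)
    have A: "A \<noteq> []" "last A = p ! i" "hd A = u"
      using lens last_conv_nth[of A] ne by (auto simp: A_def u_def)
    have B: "B \<noteq> []" "hd B = p ! Suc i" "last B = v"
      using lens i by (auto simp: B_def v_def m_def hd_drop_conv_nth)
    have "is_cycle V E (A @ rev B)"
      using p A B i unfolding pAB
      by (auto simp: is_cycle_iff successively_append_iff hd_rev last_rev intro: E_sym)
    then show ?thesis using that[of "A @ rev B"] pAB by auto
  qed
qed

text \<open>The Bondy-Chvatal closure for cycles through prescribed vertices, undoing one added pair
  at a time. A cycle that uses the pair becomes a path between its two vertices, which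
  \<open>close_path\<close> closes in the smaller graph. Closing may pick up a vertex off the path,
  hence the inclusion of vertex sets in the conclusion.\<close>

lemma cycle_of_closure:
  assumes "finite F" and "\<And>u v. (u, v) \<in> F \<Longrightarrow> u \<noteq> v \<and> u \<in> V \<and> v \<in> V \<and> card V \<le> d u + d v"
    and "is_cycle V (\<lambda>x y. E x y \<or> (x, y) \<in> F \<or> (y, x) \<in> F) xs"
  shows "\<exists>ys. is_cycle V E ys \<and> set xs \<subseteq> set ys"
  using assms
proof (induction F arbitrary: xs rule: finite_induct)
  case empty
  then show ?case by auto
next
  case (insert e F)
  obtain u v where e: "e = (u, v)" by (cases e)
  have uv: "u \<noteq> v" "u \<in> V" "v \<in> V" "card V \<le> d u + d v" using insert.prems(1)[of u v] e by auto
  define E1 where "E1 = (\<lambda>x y. E x y \<or> (x, y) \<in> F \<or> (y, x) \<in> F)"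
  define E2 where "E2 = (\<lambda>x y. E x y \<or> (x, y) \<in> insert e F \<or> (y, x) \<in> insert e F)"
  have E2: "E2 x y \<Longrightarrow> E1 x y \<or> {x, y} = {u, v}" for x y by (auto simp: E2_def E1_def e)
  have cyc: "is_cycle V E2 xs" using insert.prems(2) by (simp add: E2_def)
  have IH: "\<exists>ys. is_cycle V E ys \<and> set zs \<subseteq> set ys" if "is_cycle V E1 zs" for zs
    by (rule insert.IH) (use insert.prems(1) that in \<open>auto simp: E1_def\<close>)
  interpret G1: sgraph V E1
  proof
    show "\<not> E1 x x" for x using insert.prems(1)[of x x] by (auto simp: E1_def)
    show "E1 x y \<Longrightarrow> x \<in> V \<and> y \<in> V" for x y
      using insert.prems(1)[of x y] insert.prems(1)[of y x] E_V by (auto simp: E1_def)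
  qed (auto simp: E1_def intro: E_sym)
  have mono: "d x \<le> degree V E1 x" for x
    unfolding degree_def by (rule card_mono) (auto simp: E1_def)
  show ?case
  proof (cases "is_cycle V E1 xs")
    case True
    then show ?thesis by (rule IH)
  next
    case False
    \<comment> \<open>The cycle is rotated so that the added pair becomes its closing edge. As the
      list is distinct and has at least three entries, the pair does not occur as an inner step as
      well.\<close>
    have "\<exists>p. is_cycle V E2 p \<and> set p = set xs \<and> {last p, hd p} = {u, v}"
    proof (cases "E1 (last xs) (hd xs)")
      case False
      then show ?thesis using cyc E2[of "last xs" "hd xs"] by (intro exI[of _ xs]) (auto simp: is_cycle_iff)
    next
      case True
      with \<open>\<not> is_cycle V E1 xs\<close> cyc have "\<not> successively E1 xs" by (auto simp: is_cycle_iff)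
      then obtain i where i: "Suc i < length xs" "\<not> E1 (xs ! i) (xs ! Suc i)"
        by (auto simp: successively_conv_nth)
      define A where "A = take (Suc i) xs"
      define B where "B = drop (Suc i) xs"
      have AB: "xs = A @ B" by (simp add: A_def B_def)
      have l: "last A = xs ! i" "hd B = xs ! Suc i" "A \<noteq> []" "B \<noteq> []"
        using i by (simp_all add: A_def B_def hd_drop_conv_nth take_Suc_conv_app_nth)
      have "E2 (xs ! i) (xs ! Suc i)" using cyc i by (auto simp: is_cycle_iff successively_conv_nth)
      then have "{xs ! i, xs ! Suc i} = {u, v}" using E2 i by blast
      moreover have "is_cycle V E2 (B @ A)" using cyc unfolding AB by (simp add: is_cycle_append_commute)
      ultimately show ?thesis using l AB by (intro exI[of _ "B @ A"]) auto
    qed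
    then obtain p where p: "is_cycle V E2 p" "set p = set xs" "{last p, hd p} = {u, v}" by blast
    have p': "distinct p" "3 \<le> length p" "set p \<subseteq> V" "successively E2 p" using p by (auto simp: is_cycle_iff)
    have ends: "hd p = p ! 0" "last p = p ! (length p - 1)"
      using p'(2) by (cases p; simp add: last_conv_nth)+
    have "successively E1 p"
      unfolding successively_conv_nth
    proof (intro allI impI)
      fix i assume i: "Suc i < length p"
      have "E2 (p ! i) (p ! Suc i)" using p'(4) i by (auto simp: successively_conv_nth)
      moreover have "{p ! i, p ! Suc i} \<noteq> {u, v}"
      proof
        assume "{p ! i, p ! Suc i} = {u, v}"
        then have "{p ! i, p ! Suc i} = {p ! (length p - 1), p ! 0}" using p(3) ends by simp
        moreover have "p ! i \<noteq> p ! (length p - 1)" "p ! Suc i \<noteq> p ! 0"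
          using i p'(2) nth_eq_iff_index_eq[OF p'(1), of i "length p - 1"]
            nth_eq_iff_index_eq[OF p'(1), of "Suc i" 0]
          by linarith+
        ultimately have "p ! i = p ! 0" "p ! Suc i = p ! (length p - 1)" by blast+
        moreover have "0 < length p" "length p - 1 < length p" using p'(2) by linarith+
        ultimately have "i = 0" "Suc i = length p - 1"
          using i nth_eq_iff_index_eq[OF p'(1), of i 0] nth_eq_iff_index_eq[OF p'(1), of "Suc i" "length p - 1"]
          by linarith+
        then show False using p'(2) by simp
      qed
      ultimately show "E1 (p ! i) (p ! Suc i)" using E2 by blast
    qed
    moreover have "card V \<le> degree V E1 (hd p) + degree V E1 (last p)"
    proof -
      have "hd p = u \<and> last p = v \<or> hd p = v \<and> last p = u" using p(3) by (auto simp: doubleton_eq_iff)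
      then show ?thesis using uv(4) mono[of u] mono[of v] by auto
    qed
    ultimately obtain c where "is_cycle V E1 c" "set p \<subseteq> set c"
      using G1.close_path p' by metis
    then show ?thesis using IH[of c] p(2) by blast
  qed
qed

definition heavy :: "'a \<Rightarrow> bool" where
  "heavy x \<longleftrightarrow> x \<in> V \<and> card V + 1 \<le> 2 * d x"

lemma nbr_if_connected:
  assumes "connected S E" "x \<in> S" "y \<in> S" "x \<noteq> y"
  obtains a where "a \<in> S" "E x a"
proof -
  obtain xs where xs: "walk_in S E xs" "hd xs = x" "last xs = y"
    using assms unfolding connected_def by blast
  then obtain ys where ys: "xs = x # ys" by (cases xs) (auto simp: walk_in_iff)
  then have "ys \<noteq> []" using xs assms(4) by auto
  with xs(1) ys have "hd ys \<in> S" "E x (hd ys)" by (auto simp: walk_in_iff successively_Cons)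
  then show ?thesis by (rule that)
qed

lemma exists_other:
  assumes "card V \<ge> 3"
  obtains z where "z \<in> V" "z \<noteq> x" "z \<noteq> y"
proof -
  have "card {x, y} < card V" using assms card_length[of "[x,y]"] by simp
  then have "\<not> V \<subseteq> {x, y}" using card_mono[of "{x,y}" V] by auto
  then show ?thesis using that by blast
qed

text \<open>Deleting one neighbour \<open>a\<close> leaves \<open>x\<close> a second neighbour
  \<open>b\<close>, and a path from \<open>a\<close> to \<open>b\<close> that avoids
  \<open>x\<close> closes up at \<open>x\<close>.\<close>

lemma cycle_through_vertex:
  assumes two: "two_connected V E" and x: "x \<in> V"
  obtains c where "is_cycle V E c" "x \<in> set c"
proof -
  have card: "card V \<ge> 3" and con: "connected V E" and con': "\<And>z. z \<in> V \<Longrightarrow> connected (V - {z}) E"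
    using two by (auto simp: two_connected_def)
  obtain y where y: "y \<in> V" "y \<noteq> x" using exists_other[OF card] by metis
  obtain a where a: "a \<in> V" "E x a" using nbr_if_connected[OF con x y(1)] y by metis
  obtain z where z: "z \<in> V" "z \<noteq> x" "z \<noteq> a" using exists_other[OF card] by metis
  obtain b where b: "b \<in> V - {a}" "E x b"
    using nbr_if_connected[OF con'[OF a(1)], of x z] x z a by (metis DiffI E_neq singletonD)
  have "a \<in> V - {x}" "b \<in> V - {x}" using a b by (auto dest: E_neq)
  then obtain ws where "walk_in (V - {x}) E ws" "hd ws = a" "last ws = b"
    using con'[OF x] unfolding connected_def by blast
  then obtain ys where ys: "walk_in (V - {x}) E ys" "hd ys = a" "last ys = b" "distinct ys"
    using shortest_walk[of "V - {x}" E ws a "{b}"] by auto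
  then obtain t where t: "ys = a # t" by (cases ys) (auto simp: walk_in_iff)
  then have "t \<noteq> []" using b(1) ys by auto
  then have "length ys \<ge> 2" using t by (cases t) auto
  then have "is_cycle V E (x # ys)"
    using ys a b x by (auto simp: is_cycle_iff walk_in_iff successively_Cons intro: E_sym)
  then show ?thesis by (rule that) simp
qed

text \<open>Joining all pairs of heavy vertices turns any ordering of three or more of them into a
  cycle, which \<open>cycle_of_closure\<close> brings back to the graph. Two heavy vertices have a
  common neighbour, and the path through it can be closed; fewer are covered by
  \<open>cycle_through_vertex\<close>.\<close>

lemma cycle_through_heavy:
  assumes two: "two_connected V E"
  obtains c where "is_cycle V E c" "\<And>x. heavy x \<Longrightarrow> x \<in> set c"
proof -
  define H where "H = {x. heavy x}"
  have HV: "H \<subseteq> V" by (auto simp: H_def heavy_def)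
  have fH: "finite H" by (rule finite_subset[OF HV fin])
  have deg: "card V + 1 \<le> d x + d y" if "x \<in> H" "y \<in> H" for x y
    using that by (auto simp: H_def heavy_def)
  obtain w where w: "w \<in> V" using two by (auto simp: two_connected_def) fastforce
  consider "H = {}" | h where "H = {h}" | h k where "H = {h, k}" "h \<noteq> k" | "card H \<ge> 3"
  proof -
    have "card H = 0 \<or> card H = 1 \<or> card H = 2 \<or> card H \<ge> 3" by linarith
    then show ?thesis
    proof (elim disjE)
      assume "card H = 2"
      then obtain h k where "H = {h, k}" "h \<noteq> k" by (meson card_2_iff)
      then show ?thesis by (rule that(3))
    qed (use that fH in \<open>simp_all add: card_1_singleton_iff, blast\<close>)
  qed
  then have "\<exists>c. is_cycle V E c \<and> H \<subseteq> set c"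
  proof cases
    case 1
    obtain c where "is_cycle V E c" by (rule cycle_through_vertex[OF two w])
    with 1 show ?thesis by auto
  next
    case 2
    then have "h \<in> V" using HV by simp
    then obtain c where "is_cycle V E c" "h \<in> set c" by (rule cycle_through_vertex[OF two])
    with 2 show ?thesis by auto
  next
    case (3 h k)
    have "card {c. E h c \<and> E k c} > 0"
      using card_common_nbrs[of h k] deg[of h k] 3 by auto
    then have "{c. E h c \<and> E k c} \<noteq> {}" using card_gt_0_iff by blast
    then obtain c where c: "E h c" "E k c" by blast
    have "distinct [h, c, k]" "successively E [h, c, k]" "set [h, c, k] \<subseteq> V"
      using c 3 HV E_V by (auto dest: E_neq E_sym)
    moreover have "card V \<le> d (hd [h, c, k]) + d (last [h, c, k])" using deg[of h k] 3 by auto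
    ultimately obtain c' where "is_cycle V E c'" "set [h, c, k] \<subseteq> set c'"
      using close_path[of "[h, c, k]"] by auto
    then show ?thesis using 3 by auto
  next
    case 4
    obtain hs where hs: "set hs = H" "distinct hs" using finite_distinct_list[OF fH] by blast
    define F where "F = {(u, v). u \<in> H \<and> v \<in> H \<and> u \<noteq> v}"
    have "F \<subseteq> H \<times> H" by (auto simp: F_def)
    then have "finite F" using fH by (meson finite_SigmaI finite_subset)
    moreover have len: "3 \<le> length hs" using 4 hs by (simp flip: distinct_card)
    moreover have "is_cycle V (\<lambda>x y. E x y \<or> (x, y) \<in> F \<or> (y, x) \<in> F) hs"
      unfolding is_cycle_iff successively_conv_nth
    proof (intro conjI allI impI)
      fix i assume "Suc i < length hs"
      then have "hs ! i \<noteq> hs ! Suc i" "hs ! i \<in> H" "hs ! Suc i \<in> H"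
        using hs by (auto simp: nth_eq_iff_index_eq simp flip: hs(1))
      then show "E (hs ! i) (hs ! Suc i) \<or> (hs ! i, hs ! Suc i) \<in> F \<or> (hs ! Suc i, hs ! i) \<in> F"
        by (auto simp: F_def)
    next
      have "last hs \<noteq> hd hs" "last hs \<in> H" "hd hs \<in> H"
        using hs len by (cases hs; auto)+
      then show "E (last hs) (hd hs) \<or> (last hs, hd hs) \<in> F \<or> (hd hs, last hs) \<in> F" by (auto simp: F_def)
    qed (use hs len HV in auto)
    moreover have "u \<noteq> v \<and> u \<in> V \<and> v \<in> V \<and> card V \<le> d u + d v" if "(u, v) \<in> F" for u v
      using that HV deg[of u v] by (auto simp: F_def)
    ultimately show ?thesis
      using cycle_of_closure[of F hs] hs(1) by simp
  qed
  then show ?thesis using that by (auto simp: H_def)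
qed

end

section \<open>Hamiltonicity\<close>

context sgraph
begin

text \<open>Let \<open>x\<close> be the first contact of a walk from \<open>q\<close> with the cycle
  and \<open>r\<close> the vertex before it. Deleting \<open>x\<close> leaves a path from
  \<open>r\<close> to a first contact \<open>y\<close>, necessarily different from \<open>x\<close>.
  The vertex \<open>q\<close> itself need not lie on the ear.\<close>

lemma exists_ear:
  assumes two: "two_connected V E" and cyc: "is_cycle V E xs" and q: "q \<in> V" "q \<notin> set xs"
  obtains x y rs where "x \<in> set xs" "y \<in> set xs" "x \<noteq> y" "rs \<noteq> []" "set rs \<subseteq> V - set xs" "distinct rs"
    "successively E (x # rs @ [y])"
proof -
  have V: "set xs \<subseteq> V" "xs \<noteq> []" using cyc by (auto simp: is_cycle_iff)
  then have "hd xs \<in> V" by auto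
  then obtain ws where ws: "walk_in V E ws" "hd ws = q" "last ws = hd xs"
    using two q unfolding two_connected_def connected_def by blast
  then have "last ws \<in> set xs" using V by simp
  from shortest_walk[OF ws(1,2) this] obtain ys where ys: "walk_in V E ys" "hd ys = q" "last ys \<in> set xs"
    "set (butlast ys) \<inter> set xs = {}" by blast
  define x where "x = last ys"
  define r where "r = last (butlast ys)"
  have y_eq: "ys = butlast ys @ [x]" using ys by (simp add: x_def walk_in_iff)
  have b_ne: "butlast ys \<noteq> []" using ys q y_eq x_def by (metis append_Nil list.sel(1))
  then have "r \<in> set (butlast ys)" by (simp add: r_def)
  then have r: "r \<in> V" "r \<notin> set xs" using ys by (auto simp: walk_in_iff dest: in_set_butlastD)
  have xr: "E x r"
    using ys(1) b_ne by (subst (asm) y_eq) (auto simp: walk_in_iff successively_append_iff r_def intro: E_sym)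
  have x: "x \<in> set xs" using ys by (simp add: x_def)
  have "\<exists>c \<in> set xs. c \<noteq> x"
  proof (rule ccontr)
    assume "\<not> ?thesis"
    then have "card (set xs) \<le> card {x}" by (intro card_mono) auto
    then show False using cyc by (auto simp: is_cycle_iff distinct_card)
  qed
  then obtain c where c: "c \<in> set xs" "c \<noteq> x" by blast
  have "connected (V - {x}) E" using two x V by (auto simp: two_connected_def)
  moreover have "r \<in> V - {x}" "c \<in> V - {x}" using r x c V by auto
  ultimately obtain us where us: "walk_in (V - {x}) E us" "hd us = r" "last us = c"
    unfolding connected_def by blast
  then have "last us \<in> set xs" using c by simp
  from shortest_walk[OF us(1,2) this] obtain zs where zs: "walk_in (V - {x}) E zs" "hd zs = r" "last zs \<in> set xs"
    "distinct zs" "set (butlast zs) \<inter> set xs = {}" by blast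
  define y where "y = last zs"
  have z_eq: "zs = butlast zs @ [y]" using zs by (simp add: y_def walk_in_iff)
  have ne: "butlast zs \<noteq> []" using zs r z_eq y_def by (metis append_Nil list.sel(1))
  have "y \<in> set zs" using z_eq by (metis in_set_conv_decomp)
  then have "y \<noteq> x" using zs by (auto simp: walk_in_iff)
  moreover have "successively E (x # zs)" using zs(1,2) xr by (simp add: walk_in_iff successively_Cons)
  then have "successively E (x # butlast zs @ [y])" using z_eq by simp
  moreover have "set (butlast zs) \<subseteq> V - set xs" using zs by (auto simp: walk_in_iff dest: in_set_butlastD)
  ultimately show ?thesis
    using that[of x y "butlast zs"] x zs ne by (auto simp: y_def distinct_butlast)
qed

end

text \<open>The pairs at distance 2 are the pairs of leaves of the claw and, up to reversal, the
  pair \<open>p\<close>, \<open>r\<close> of the path. So an induced claw has at most one light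
  leaf, and of two vertices at distance 2 on an induced path on four vertices at least one is
  heavy.\<close>

locale heavy_graph = sgraph +
  assumes claw: "\<lbrakk>E c a; E c b; E c e; a \<noteq> b; a \<noteq> e; b \<noteq> e; \<not> E a b; \<not> E a e; \<not> E b e;
      \<not> heavy a; \<not> heavy b\<rbrakk> \<Longrightarrow> False"
    and P4: "\<lbrakk>E p q; E q r; E r s; p \<noteq> r; p \<noteq> s; q \<noteq> s; \<not> E p r; \<not> E p s; \<not> E q s;
      \<not> heavy p; \<not> heavy r\<rbrakk> \<Longrightarrow> False"
begin

text \<open>Passing through all heavy vertices makes every vertex off the cycle light, which is what
  \<open>claw\<close> and \<open>P4\<close> need.\<close>

definition max_cycle :: "'a list \<Rightarrow> bool" where
  "max_cycle xs \<longleftrightarrow> is_cycle V E xs \<and> (\<forall>x. heavy x \<longrightarrow> x \<in> set xs) \<and>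
     (\<forall>ys. is_cycle V E ys \<and> (\<forall>x. heavy x \<longrightarrow> x \<in> set ys) \<longrightarrow> length ys \<le> length xs)"

lemma max_cycle_not_extendable:
  assumes "max_cycle xs" "is_cycle V E ys" "set xs \<subseteq> set ys" "z \<in> set ys" "z \<notin> set xs"
  shows False
proof -
  have "length ys \<le> length xs" using assms(1-3) unfolding max_cycle_def by blast
  moreover have "card (set xs) < card (set ys)" using assms by (intro psubset_card_mono) auto
  ultimately show False using assms by (auto simp: max_cycle_def is_cycle_iff distinct_card)
qed

lemma max_cycle_same_set:
  assumes "max_cycle xs" "is_cycle V E ys" "set ys = set xs"
  shows "max_cycle ys"
proof -
  have "length ys = length xs"
    using assms by (auto simp: max_cycle_def is_cycle_iff simp flip: distinct_card)
  then show ?thesis using assms by (auto simp: max_cycle_def)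
qed

text \<open>Let \<open>l\<close> precede \<open>x\<close> and \<open>w\<close> follow
  \<open>v\<close>. The outside vertex \<open>r\<close> is light, and an edge from \<open>r\<close>
  to \<open>v\<close> or \<open>l\<close> would insert \<open>r\<close> into the cycle. So the claw
  at \<open>x\<close> with leaves \<open>r\<close>, \<open>v\<close>, \<open>l\<close> forces the
  edge l v, the path r, x, v, w forces x w, and \<open>v\<close> can move to the place between
  \<open>l\<close> and \<open>x\<close>.\<close>

lemma max_cycle_shift:
  assumes m: "max_cycle (x # v # ys)" and r: "r \<notin> set (x # v # ys)" "E x r" and v: "\<not> heavy v"
  shows "max_cycle (x # ys @ [v])"
proof -
  note ext = max_cycle_not_extendable[OF m, of _ r]
  have cyc: "is_cycle V E (x # v # ys)" using m by (simp add: max_cycle_def)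
  then have ne: "ys \<noteq> []" by (auto simp: is_cycle_iff)
  define w where "w = hd ys"
  define l where "l = last ys"
  obtain ys' where ys': "ys = w # ys'" using ne by (cases ys) (auto simp: w_def)
  have l: "l \<in> set ys" "w \<in> set ys" using ne by (auto simp: l_def w_def)
  have E: "E x v" "E v w" "E l x" and rV: "r \<in> V"
    using cyc ne r E_V by (auto simp: is_cycle_iff successively_Cons w_def l_def)
  have rl: "\<not> heavy r" using m r by (auto simp: max_cycle_def)
  have 1: "\<not> E r v"
  proof
    assume "E r v"
    then have "is_cycle V E (x # r # v # ys)" using cyc r rV by (auto simp: is_cycle_iff)
    then show False by (rule ext) (use r in auto)
  qed
  have 2: "\<not> E r l"
  proof
    assume "E r l"
    then have "is_cycle V E (x # v # ys @ [r])"
      using cyc r rV ne by (auto simp: is_cycle_iff successively_Cons successively_append_iff l_def intro: E_sym)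
    then show False by (rule ext) (use r in auto)
  qed
  have vl: "E l v"
    using claw[of x r v l] E r 1 2 rl v l cyc by (auto simp: is_cycle_iff intro: E_sym)
  \<comment> \<open>Here \<open>r\<close> cannot be inserted at once. With \<open>w2\<close> the
    vertex after \<open>w\<close>, the claw at \<open>w\<close> with leaves \<open>r\<close>,
    \<open>v\<close>, \<open>w2\<close> yields the edge v w2, and x, r, w, v, w2 is a detour that
    takes \<open>r\<close> in.\<close>
  have 3: "\<not> E r w"
  proof
    assume rw: "E r w"
    then have "ys' \<noteq> []" using 2 ys' by (auto simp: l_def)
    define w2 where "w2 = hd ys'"
    have w2: "w2 \<in> set ys'" "E w w2" using cyc \<open>ys' \<noteq> []\<close> by (auto simp: ys' is_cycle_iff successively_Cons w2_def)
    have "\<not> E r w2"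
    proof
      assume "E r w2"
      then have "is_cycle V E (x # v # w # r # ys')"
        using cyc r rV rw \<open>ys' \<noteq> []\<close> by (auto simp: is_cycle_iff ys' successively_Cons w2_def intro: E_sym)
      then show False by (rule ext) (use r ys' in auto)
    qed
    then have "E v w2"
      using claw[of w r v w2] rw w2 E r 1 rl v cyc ys' by (auto simp: is_cycle_iff intro: E_sym)
    then have "is_cycle V E (x # r # w # v # ys')"
      using cyc r rV rw E \<open>ys' \<noteq> []\<close> by (auto simp: is_cycle_iff ys' successively_Cons w2_def intro: E_sym)
    then show False by (rule ext) (use r ys' in auto)
  qed
  have "E x w"
    using P4[of r x v w] E r 1 3 rl v l cyc by (auto simp: is_cycle_iff intro: E_sym)
  then have "is_cycle V E (x # ys @ [v])"
    using cyc vl E ne by (auto simp: is_cycle_iff successively_Cons successively_append_iff hd_append w_def l_def intro: E_sym)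
  then show ?thesis by (rule max_cycle_same_set[OF m]) auto
qed

lemma max_cycle_rotate_light:
  assumes "max_cycle (x # as @ b # bs)" "r \<notin> set (x # as @ b # bs)" "E x r" "\<forall>a\<in>set as. \<not> heavy a"
  shows "max_cycle (x # b # bs @ as)"
  using assms
proof (induction as arbitrary: bs)
  case (Cons a as)
  have "max_cycle (x # (as @ b # bs) @ [a])"
    by (rule max_cycle_shift[of _ _ _ r]) (use Cons.prems in auto)
  then have "max_cycle (x # b # (bs @ [a]) @ as)"
    by (intro Cons.IH) (use Cons.prems in auto)
  then show ?case by simp
qed simp

text \<open>Both ends \<open>x\<close> and \<open>y\<close> of an ear can be moved along the cycle past light vertices until each is
  followed by a heavy vertex; the two heavy successors are then the ends of a path covering the cycle and the
  ear.\<close>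
theorem max_cycle_hamiltonian:
  assumes two: "two_connected V E" and m: "max_cycle xs"
  shows "set xs = V"
proof (rule ccontr)
  assume "set xs \<noteq> V"
  moreover have cyc: "is_cycle V E xs" using m by (simp add: max_cycle_def)
  ultimately obtain q where "q \<in> V" "q \<notin> set xs" by (auto simp: is_cycle_iff)
  from exists_ear[OF two cyc this] obtain x y rs where
    xy: "x \<in> set xs" "y \<in> set xs" "x \<noteq> y" and rs: "rs \<noteq> []" "set rs \<subseteq> V - set xs" "distinct rs"
      "successively E (x # rs @ [y])" by blast
  have rsE: "E x (hd rs)" "E (last rs) y" "successively E rs"
    using rs by (auto simp: successively_Cons successively_append_iff hd_append)
  have no_ext: False if "max_cycle zs" "set zs = set xs" "is_cycle V E c" "set xs \<subseteq> set c" "set rs \<subseteq> set c" for zs c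
  proof -
    have "hd rs \<in> set c" "hd rs \<notin> set zs" using that(2,5) rs(2) hd_in_set[OF rs(1)] by blast+
    then show False using max_cycle_not_extendable[OF that(1,3)] that(2,4) by blast
  qed
  have no_ear: False if "max_cycle (x # y # zs)" "set (x # y # zs) = set xs" for zs
  proof -
    have "is_cycle V E (x # rs @ y # zs)"
      using that rs rsE by (auto simp: max_cycle_def is_cycle_iff successively_Cons successively_append_iff hd_append)
    then show False by (rule no_ext[OF that]) (use that in auto)
  qed
  have no_ear': False if "max_cycle (y # x # zs)" "set (y # x # zs) = set xs" for zs
  proof -
    have "is_cycle V E (y # rev rs @ x # zs)"
      using that rs rsE by (auto simp: max_cycle_def is_cycle_iff successively_Cons successively_append_iff
          hd_append hd_rev last_rev intro: E_sym)
    then show False by (rule no_ext[OF that]) (use that in auto)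
  qed
  obtain as0 bs0 where xs: "xs = as0 @ x # bs0" using xy by (meson split_list)
  define zs where "zs = bs0 @ as0"
  have mz: "max_cycle (x # zs)"
    by (rule max_cycle_same_set[OF m])
      (use cyc is_cycle_append_commute[of V E as0 "x # bs0"] in \<open>auto simp: xs zs_def\<close>)
  have sz: "set (x # zs) = set xs" by (auto simp: xs zs_def)
  then have "\<exists>b\<in>set zs. heavy b \<or> b = y" using xy by auto
  then obtain as b bs where zs: "zs = as @ b # bs" "heavy b \<or> b = y" "\<forall>a\<in>set as. \<not> (heavy a \<or> a = y)"
    by (rule split_list_first_propE)
  have hd_off: "hd rs \<notin> set xs" "last rs \<notin> set xs" using rs(2) hd_in_set[OF rs(1)] last_in_set[OF rs(1)] by blast+
  have m1: "max_cycle (x # b # bs @ as)"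
    by (rule max_cycle_rotate_light[of _ _ _ _ "hd rs"]) (use mz zs sz hd_off rsE in auto)
  have s1: "set (x # b # bs @ as) = set xs" using sz zs by auto
  have b_y: "b \<noteq> y" using no_ear[of "bs @ as"] m1 s1 by blast
  then have hb: "heavy b" using zs by auto
  have "y \<in> set (bs @ as)" using s1 xy b_y by auto
  then obtain c1 c2 where c12: "bs @ as = c1 @ y # c2" by (meson split_list)
  have m2: "max_cycle (y # c2 @ x # b # c1)"
    by (rule max_cycle_same_set[OF m1])
      (use m1 is_cycle_append_commute[of V E "x # b # c1" "y # c2"] in \<open>auto simp: c12 max_cycle_def\<close>)
  have s2: "set (y # c2 @ x # b # c1) = set xs" using s1 c12 by auto
  show False
  proof (cases "\<exists>h\<in>set c2. heavy h")
    \<comment> \<open>With only light vertices between \<open>y\<close> and \<open>x\<close>,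
      rotation makes \<open>x\<close> follow \<open>y\<close>, and the ear replaces that
      edge.\<close>
    case False
    then have "max_cycle (y # x # (b # c1) @ c2)"
      by (intro max_cycle_rotate_light[of _ _ _ _ "last rs"]) (use m2 s2 hd_off rsE in \<open>auto intro: E_sym\<close>)
    then show False by (rule no_ear') (use s2 in auto)
  next
    case True
    then obtain as' h bs' where c2: "c2 = as' @ h # bs'" "heavy h" "\<forall>a\<in>set as'. \<not> heavy a"
      by (rule split_list_first_propE)
    have m3: "max_cycle (y # h # (bs' @ x # b # c1) @ as')"
      by (rule max_cycle_rotate_light[of _ _ _ _ "last rs"])
        (use m2 s2 c2 hd_off rsE in \<open>auto intro: E_sym\<close>)
    have s3: "set (y # h # (bs' @ x # b # c1) @ as') = set xs" using s2 c2 by auto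
    define e where "e = c1 @ as'"
    have cy: "is_cycle V E (y # h # bs' @ x # b # e)" using m3 by (simp add: max_cycle_def e_def)
    \<comment> \<open>The edges y h and x b of the cycle are dropped: \<open>p\<close> runs from
      \<open>h\<close> along the cycle to \<open>x\<close>, over the ear to \<open>y\<close>, and
      backwards along \<open>e\<close> to \<open>b\<close>.\<close>
    define p where "p = (h # bs' @ [x]) @ rs @ (y # rev e @ [b])"
    have "successively E p"
      using cy rsE rs(1) unfolding p_def
      by (auto simp: is_cycle_iff successively_Cons successively_append_iff hd_append hd_rev last_rev intro: E_sym)
    moreover have "distinct p" "set p \<subseteq> V" "3 \<le> length p"
      using cy rs s3 by (auto simp: is_cycle_iff p_def e_def)
    moreover have "card V \<le> d (hd p) + d (last p)" using hb c2 by (simp add: p_def heavy_def)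
    ultimately obtain c where c: "is_cycle V E c" "set p \<subseteq> set c" using close_path by blast
    show False by (rule no_ext[OF m3 s3 c(1)]) (use c(2) s3 in \<open>auto simp: p_def e_def\<close>)
  qed
qed

theorem hamiltonian:
  assumes two: "two_connected V E"
  obtains xs where "is_cycle V E xs" "set xs = V"
proof -
  define W where "W = {xs. is_cycle V E xs \<and> (\<forall>x. heavy x \<longrightarrow> x \<in> set xs)}"
  obtain c where "is_cycle V E c" "\<And>x. heavy x \<Longrightarrow> x \<in> set c" using cycle_through_heavy[OF two] by blast
  then have "c \<in> W" by (simp add: W_def)
  moreover have "\<forall>y. y \<in> W \<longrightarrow> length y < Suc (card V)"
    using cycle_length_le by (auto simp: W_def less_Suc_eq_le)
  ultimately obtain xs where "xs \<in> W" "\<forall>y. y \<in> W \<longrightarrow> length y \<le> length xs"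
    using ex_has_greatest_nat[of "\<lambda>x. x \<in> W" c length "Suc (card V)"] by auto
  then have m: "max_cycle xs" by (auto simp: max_cycle_def W_def)
  then have "is_cycle V E xs" by (simp add: max_cycle_def)
  then show ?thesis using max_cycle_hamiltonian[OF two m] by (rule that)
qed

end

section \<open>Hamilton cycles without consecutive heavy vertices\<close>

definition nxt :: "'a list \<Rightarrow> 'a \<Rightarrow> 'a \<Rightarrow> bool" where
  "nxt xs a b \<longleftrightarrow> (\<exists>as bs. xs = as @ a # b # bs) \<or> (xs \<noteq> [] \<and> a = last xs \<and> b = hd xs)"

lemma nxt_append: "nxt (as @ a # b # bs) a b"
  unfolding nxt_def by blast

lemma nxt_Cons: "nxt (a # b # bs) a b"
  using nxt_append[of "[]"] by simp

lemma nxt_last: "xs \<noteq> [] \<Longrightarrow> nxt xs (last xs) (hd xs)"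
  by (simp add: nxt_def)

lemma nxt_rotate_imp: "nxt (xs @ ys) a b \<Longrightarrow> nxt (ys @ xs) a b"
proof (induction xs arbitrary: ys)
  case (Cons x xs)
  have "nxt ((xs @ ys) @ [x]) a b"
    using Cons.prems unfolding nxt_def
  proof
    assume "\<exists>as bs. (x # xs) @ ys = as @ a # b # bs"
    then obtain as bs where eq: "x # (xs @ ys) = as @ a # b # bs" by auto
    show "(\<exists>as bs. (xs @ ys) @ [x] = as @ a # b # bs) \<or>
      (xs @ ys) @ [x] \<noteq> [] \<and> a = last ((xs @ ys) @ [x]) \<and> b = hd ((xs @ ys) @ [x])"
    proof (cases as)
      case Nil
      then show ?thesis using eq by auto
    next
      case (Cons c cs)
      then have "(xs @ ys) @ [x] = cs @ a # b # (bs @ [x])" using eq by simp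
      then show ?thesis by blast
    qed
  next
    assume l: "(x # xs) @ ys \<noteq> [] \<and> a = last ((x # xs) @ ys) \<and> b = hd ((x # xs) @ ys)"
    show "(\<exists>as bs. (xs @ ys) @ [x] = as @ a # b # bs) \<or>
      (xs @ ys) @ [x] \<noteq> [] \<and> a = last ((xs @ ys) @ [x]) \<and> b = hd ((xs @ ys) @ [x])"
    proof (cases "xs @ ys = []")
      case True
      then show ?thesis using l by auto
    next
      case False
      then have "xs @ ys = butlast (xs @ ys) @ [a]" using l by (metis append_Cons append_butlast_last_id last_ConsR)
      then have "(xs @ ys) @ [x] = butlast (xs @ ys) @ a # b # []" using l by simp
      then show ?thesis by blast
    qed
  qed
  then show ?case using Cons.IH[of "ys @ [x]"] by simp
qed simp

lemma nxt_rotate: "nxt (xs @ ys) = nxt (ys @ xs)"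
  by (intro ext iffI; erule nxt_rotate_imp)

lemma nxt_rev: "nxt (rev xs) a b \<longleftrightarrow> nxt xs b a"
proof -
  have "nxt (rev xs) a b" if "nxt xs b a" for xs :: "'a list" and a b
    using that unfolding nxt_def
  proof
    assume "\<exists>as bs. xs = as @ b # a # bs"
    then obtain as bs where "xs = as @ b # a # bs" by blast
    then have "rev xs = rev bs @ a # b # rev as" by simp
    then show "(\<exists>as bs. rev xs = as @ a # b # bs) \<or> (rev xs \<noteq> [] \<and> a = last (rev xs) \<and> b = hd (rev xs))" by blast
  qed (simp add: last_rev hd_rev)
  from this[of xs b a] this[of "rev xs" a b] show ?thesis by (simp only: rev_rev_ident) blast
qed

lemma nxt_Cons_unique:
  assumes "distinct (a # xs)" "nxt (a # xs) a b"
  shows "b = hd (xs @ [a])"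
  using assms(2) unfolding nxt_def
proof
  assume "\<exists>as bs. a # xs = as @ a # b # bs"
  then obtain as bs where "a # xs = as @ a # b # bs" by blast
  then show ?thesis using assms(1) by (cases as) auto
next
  assume "a # xs \<noteq> [] \<and> a = last (a # xs) \<and> b = hd (a # xs)"
  then show ?thesis using assms(1) by (cases "xs = []") auto
qed

lemma nxt_mem: "nxt xs a b \<Longrightarrow> a \<in> set xs \<and> b \<in> set xs"
  unfolding nxt_def by auto

context sgraph
begin

section \<open>Successors and predecessors on a Hamilton cycle\<close>

definition ham :: "'a list \<Rightarrow> bool" where
  "ham xs \<longleftrightarrow> is_cycle V E xs \<and> set xs = V"

lemma ham_length: "ham xs \<Longrightarrow> length xs = card V"
  by (auto simp: ham_def is_cycle_iff simp flip: distinct_card)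

lemma ham_rev: "ham xs \<Longrightarrow> ham (rev xs)"
  by (simp add: ham_def is_cycle_rev)

text \<open>Keeping the successor relation allows facts about \<open>nxt xs\<close> to be proved on
  the list that starts at the vertex of interest.\<close>

lemma ham_rotate_to:
  assumes "ham xs" "a \<in> V"
  obtains ys where "ham (a # ys)" "nxt (a # ys) = nxt xs"
proof -
  obtain as bs where xs: "xs = as @ a # bs" using assms by (metis ham_def split_list)
  then have "ham (a # bs @ as)" using assms is_cycle_append_commute[of V E as "a # bs"] by (auto simp: ham_def)
  moreover have "nxt (a # bs @ as) = nxt xs" using nxt_rotate[of as "a # bs"] by (simp add: xs)
  ultimately show ?thesis by (rule that)
qed

lemma nxt_exists:
  assumes "ham xs" "a \<in> V" obtains b where "nxt xs a b"
proof -
  obtain ys where ys: "ham (a # ys)" "nxt (a # ys) = nxt xs" using ham_rotate_to[OF assms] .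
  then obtain b zs where "ys = b # zs" by (cases ys) (auto simp: ham_def is_cycle_iff)
  then have "nxt xs a b" using ys(2) nxt_Cons[of a b zs] by simp
  then show ?thesis by (rule that)
qed

lemma prev_exists:
  assumes "ham xs" "a \<in> V" obtains b where "nxt xs b a"
  using nxt_exists[OF ham_rev[OF assms(1)] assms(2)] nxt_rev by metis

lemma nxt_unique:
  assumes "ham xs" "nxt xs a b" "nxt xs a c" shows "b = c"
proof -
  have "a \<in> V" using assms nxt_mem by (fastforce simp: ham_def)
  then obtain ys where ys: "ham (a # ys)" "nxt (a # ys) = nxt xs" using ham_rotate_to[OF assms(1)] by blast
  have "distinct (a # ys)" using ys(1) by (simp add: ham_def is_cycle_iff)
  from nxt_Cons_unique[OF this, of b] nxt_Cons_unique[OF this, of c] show ?thesis using assms ys(2) by simp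
qed

lemma prev_unique: "ham xs \<Longrightarrow> nxt xs b a \<Longrightarrow> nxt xs c a \<Longrightarrow> b = c"
  using nxt_unique[OF ham_rev] nxt_rev by metis

lemma nxt_E:
  assumes "ham xs" "nxt xs a b" shows "E a b"
  using assms by (auto simp: ham_def is_cycle_iff nxt_def successively_append_iff)

lemma nxt_V: "ham xs \<Longrightarrow> nxt xs a b \<Longrightarrow> a \<in> V \<and> b \<in> V"
  using nxt_E E_V by blast

lemma ham_split:
  assumes "ham (a # ys)"
  obtains b zs c where "ys = b # zs @ [c]" "nxt (a # ys) a b" "nxt (a # ys) c a"
proof -
  have "length ys \<ge> 2" using assms by (auto simp: ham_def is_cycle_iff)
  then obtain b ys' where ys': "ys = b # ys'" "ys' \<noteq> []" by (cases ys; cases "tl ys") auto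
  then have "ys = b # butlast ys' @ [last ys']" by simp
  moreover have "nxt (a # ys) a b" using ys' nxt_Cons by metis
  moreover have "nxt (a # ys) (last ys') a" using nxt_last[of "a # ys"] ys' by simp
  ultimately show ?thesis by (rule that)
qed

lemma prev_neq_next:
  assumes "ham xs" "nxt xs p a" "nxt xs a q" shows "p \<noteq> q"
proof -
  have "a \<in> V" using assms nxt_V by blast
  then obtain ys where ys: "ham (a # ys)" "nxt (a # ys) = nxt xs" using ham_rotate_to[OF assms(1)] by blast
  obtain b zs c where b: "ys = b # zs @ [c]" "nxt (a # ys) a b" "nxt (a # ys) c a" using ham_split[OF ys(1)] .
  then have "p = c" "q = b" using assms ys(2) nxt_unique[OF assms(1)] prev_unique[OF assms(1)] by metis+
  then show ?thesis using ys(1) b(1) by (auto simp: ham_def is_cycle_iff)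
qed

lemma degree_ge_2: "ham xs \<Longrightarrow> a \<in> V \<Longrightarrow> d a \<ge> 2"
proof -
  assume h: "ham xs" and a: "a \<in> V"
  obtain p where p: "nxt xs p a" using prev_exists[OF h a] .
  obtain q where q: "nxt xs a q" using nxt_exists[OF h a] .
  have "{p, q} \<subseteq> {y. E a y}" using p q nxt_E[OF h] E_sym by blast
  then have "card {p, q} \<le> d a" unfolding degree_eq by (intro card_mono) auto
  then show ?thesis using prev_neq_next[OF h p q] by simp
qed

lemma exit_edge:
  assumes h: "ham xs" and a: "a \<in> V" "P a" and b: "b \<in> V" "\<not> P b"
  obtains p q where "nxt xs p q" "P p" "\<not> P q"
proof -
  obtain ys where ys: "ham (a # ys)" "nxt (a # ys) = nxt xs" using ham_rotate_to[OF h a(1)] .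
  have "b \<in> set (a # ys)" using ys(1) b by (simp add: ham_def)
  then have "\<exists>b\<in>set ys. \<not> P b" using b a by auto
  then obtain as c bs where c: "ys = as @ c # bs" "\<not> P c" "\<forall>y\<in>set as. \<not> \<not> P y"
    by (rule split_list_first_propE)
  have "a # ys = butlast (a # as) @ last (a # as) # c # bs"
    unfolding c(1) by (metis append.assoc append_Cons append_Nil append_butlast_last_id list.distinct(1))
  then have "nxt xs (last (a # as)) c" using nxt_append ys(2) by metis
  moreover have "P (last (a # as))" using c(3) a by auto
  ultimately show ?thesis using c(2) that by blast
qed

end

text \<open>The assumption \<open>stuck\<close> speaks of every Hamilton cycle, not of a chosen one.
  So each rerouting that makes two heavy vertices consecutive is a contradiction, and this is how
  edges are excluded below.\<close>

locale stuck_graph = heavy_graph +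
  assumes ham_ex: "\<exists>xs. ham xs"
    and stuck: "ham (x # y # zs) \<Longrightarrow> d x + d y \<le> card V"
begin

definition light :: "'a \<Rightarrow> bool" where "light x \<longleftrightarrow> x \<in> V \<and> \<not> heavy x"

lemma light_V: "light x \<Longrightarrow> x \<in> V" and heavy_V: "heavy x \<Longrightarrow> x \<in> V"
  by (auto simp: light_def heavy_def)

lemma light_degree: "light x \<Longrightarrow> 2 * d x \<le> card V"
  by (auto simp: light_def heavy_def)

lemma card_V: "card V \<ge> 3"
proof -
  obtain xs where "ham xs" using ham_ex by blast
  then show ?thesis using ham_length[of xs] by (simp add: ham_def is_cycle_iff)
qed

lemma stuck_nxt:
  assumes "ham xs" "nxt xs a b" shows "d a + d b \<le> card V"
proof -
  have "a \<in> V" using assms nxt_V by blast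
  then obtain ys where ys: "ham (a # ys)" "nxt (a # ys) = nxt xs" using ham_rotate_to[OF assms(1)] by blast
  obtain b' zs c where b: "ys = b' # zs @ [c]" "nxt (a # ys) a b'" using ham_split[OF ys(1)] .
  then have "b' = b" using assms ys(2) nxt_unique by metis
  then show ?thesis using stuck ys(1) b(1) by blast
qed

lemma not_both_heavy: "ham xs \<Longrightarrow> nxt xs a b \<Longrightarrow> \<not> (heavy a \<and> heavy b)"
  using stuck_nxt[of xs a b] by (auto simp: heavy_def)

lemma light_nxt: "ham xs \<Longrightarrow> nxt xs a b \<Longrightarrow> heavy a \<Longrightarrow> light b"
  and light_prev: "ham xs \<Longrightarrow> nxt xs a b \<Longrightarrow> heavy b \<Longrightarrow> light a"
  using not_both_heavy nxt_V by (auto simp: light_def)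

section \<open>Rerouting a Hamilton cycle\<close>

lemma no_heavy_start: "ham (a # b # zs) \<Longrightarrow> heavy a \<Longrightarrow> heavy b \<Longrightarrow> False"
  using not_both_heavy nxt_Cons by metis

text \<open>Otherwise the edges a a' and b b' of the cycle could be exchanged for a b and a' b',
  reversing the part in between and making \<open>a\<close> and \<open>b\<close>
  consecutive.\<close>

lemma nxt_heavy_not_adjacent:
  assumes h: "ham xs" and ab: "heavy a" "heavy b" "E a b" and n: "nxt xs a a'" "nxt xs b b'"
  shows "\<not> E a' b'"
proof
  assume E': "E a' b'"
  obtain ys where ys: "ham (a # ys)" "nxt (a # ys) = nxt xs" using ham_rotate_to[OF h heavy_V[OF ab(1)]] .
  have "b \<in> set ys" using ys(1) heavy_V[OF ab(2)] ab(3) by (auto simp: ham_def)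
  then obtain P Q where PQ: "ys = P @ b # Q" by (meson split_list)
  have P: "P \<noteq> []" using no_heavy_start[of a b Q] ys(1) ab PQ by auto
  have Q: "Q \<noteq> []"
  proof
    assume "Q = []"
    then have "nxt xs b a" using nxt_last[of "a # ys"] ys(2) PQ by simp
    then show False using not_both_heavy h ab by blast
  qed
  have "nxt (a # ys) a (hd P)" using P by (cases P) (simp_all add: PQ nxt_Cons)
  then have hP: "hd P = a'" using n(1) nxt_unique[OF h] ys(2) by metis
  have "nxt (a # ys) b (hd Q)" using nxt_append[of "a # P" b "hd Q" "tl Q"] Q by (simp add: PQ)
  then have hQ: "hd Q = b'" using n(2) nxt_unique[OF h] ys(2) by metis
  have "ham (a # b # rev P @ Q)"
    using ys(1) P Q ab(3) E' hP hQ unfolding PQ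
    by (auto simp: ham_def is_cycle_iff successively_Cons successively_append_iff hd_append hd_rev last_rev intro: E_sym)
  then show False using no_heavy_start ab by blast
qed

lemma prev_heavy_not_adjacent:
  assumes "ham xs" "heavy a" "heavy b" "E a b" "nxt xs a' a" "nxt xs b' b"
  shows "\<not> E a' b'"
  using nxt_heavy_not_adjacent[OF ham_rev[OF assms(1)] assms(2-4)] assms(5,6) by (simp add: nxt_rev)

text \<open>The edge p q bridges the gap left by \<open>x\<close>, which is reinserted between
  \<open>b\<close> and \<open>b'\<close> and so becomes a neighbour of the heavy \<open>b\<close> on
  the cycle.\<close>

lemma no_insertion:
  assumes h: "ham xs" and x: "heavy x" "nxt xs p x" "nxt xs x q" "E p q"
    and b: "heavy b" "E b x" "nxt xs b b'" "E b' x"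
  shows False
proof -
  obtain ys where ys: "ham (x # ys)" "nxt (x # ys) = nxt xs" using ham_rotate_to[OF h heavy_V[OF x(1)]] .
  obtain q' zs p' where q': "ys = q' # zs @ [p']" "nxt (x # ys) x q'" "nxt (x # ys) p' x" using ham_split[OF ys(1)] .
  then have pq: "p' = p" "q' = q" using x ys(2) nxt_unique[OF h] prev_unique[OF h] by metis+
  have ends: "hd ys = q" "last ys = p" "ys \<noteq> []" using q'(1) pq by auto
  have "b \<in> set ys" using ys(1) heavy_V[OF b(1)] b(2) by (auto simp: ham_def)
  then obtain P Q where PQ: "ys = P @ b # Q" by (meson split_list)
  have Q: "Q \<noteq> []"
  proof
    assume "Q = []"
    then have "nxt xs b x" using nxt_last[of "x # ys"] ys(2) PQ by simp
    then show False using not_both_heavy h b x by blast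
  qed
  have "nxt (x # ys) b (hd Q)" using nxt_append[of "x # P" b "hd Q" "tl Q"] Q by (simp add: PQ)
  then have hQ: "hd Q = b'" using b(3) nxt_unique[OF h] ys(2) by metis
  have hd_ys: "hd (P @ [b]) = q" using ends PQ by (cases P) auto
  have lQ: "last Q = p" using ends PQ Q by simp
  have "is_cycle V E (P @ b # x # Q)"
    using ys(1) Q x(4) b hQ hd_ys lQ unfolding PQ
    by (auto simp: ham_def is_cycle_iff successively_Cons successively_append_iff hd_append split: if_splits intro: E_sym)
  then have "ham (P @ b # x # Q)" using ys(1) PQ by (auto simp: ham_def)
  then show False using not_both_heavy nxt_append b(1) x(1) by metis
qed

lemma no_insertion':
  assumes h: "ham xs" and x: "heavy x" "nxt xs p x" "nxt xs x q" "E p q"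
    and b: "heavy b" "E b x" "nxt xs b' b" "E b' x"
  shows False
  by (rule no_insertion[OF ham_rev[OF h] x(1), of q p b b']) (use x b in \<open>auto simp: nxt_rev intro: E_sym\<close>)

text \<open>An induced path u, w, v with light ends, the configuration on which \<open>claw\<close>
  and \<open>P4\<close> act. Later \<open>w\<close> proves to be heavy, and \<open>u\<close> and
  \<open>v\<close> represent classes of light vertices.\<close>

definition cross :: "'a \<Rightarrow> 'a \<Rightarrow> 'a \<Rightarrow> bool" where
  "cross w u v \<longleftrightarrow> light u \<and> light v \<and> u \<noteq> v \<and> \<not> E u v \<and> E w u \<and> E w v"

lemma cross_sym: "cross w u v \<Longrightarrow> cross w v u"
  by (auto simp: cross_def intro: E_sym)

text \<open>Otherwise v, w, u, p would be an induced path whose vertices \<open>v\<close> and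
  \<open>u\<close> at distance 2 are both light.\<close>

lemma cross_nbr_of_end:
  assumes "cross w u v" "E p u" "p \<noteq> w" "\<not> E p v" shows "E p w"
  using P4[of v w u p] assms unfolding cross_def light_def by (metis E_sym)

lemma cross_nbr:
  assumes "cross w u v" "E w p" "p \<noteq> u" "p \<noteq> v" shows "E p u \<or> E p v"
  using claw[of w u v p] assms unfolding cross_def light_def by (metis E_sym)

text \<open>Domination gives d u + d v = n - 2 + |C|, so |C| <= 2 for light \<open>u\<close> and
  \<open>v\<close>. By \<open>cross_nbr_of_end\<close> each vertex of \<open>C\<close> is adjacent
  to everything outside \<open>C\<close>, so d w >= n - |C|. Its neighbours on a Hamilton cycle have
  degree at least 2, so \<open>stuck_nxt\<close> caps d w at n - 2. Hence |C| = 2, the two members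
  of \<open>C\<close> are nonadjacent, and both cycle neighbours of \<open>w\<close> have degree 2.
  They are \<open>u\<close> and \<open>v\<close>, whose neighbourhoods are then exactly
  \<open>C\<close>, and domination leaves only the 4-cycle u, w, v, w'.\<close>

lemma dominated_pair_cycle_graph:
  assumes w: "cross w u v" and dom: "\<And>x. x \<in> V \<Longrightarrow> x = u \<or> x = v \<or> E x u \<or> E x v"
  shows "is_cycle_graph V E"
proof -
  define C where "C = {c. E u c \<and> E v c}"
  have uv: "light u" "light v" "u \<noteq> v" "\<not> E u v" "\<not> E v u" "E w u" "E w v" "u \<in> V" "v \<in> V" "w \<in> V"
    using w E_sym light_V E_V by (auto simp: cross_def)
  have fC: "finite C" by (simp add: C_def)
  have wC: "w \<in> C" using uv E_sym by (auto simp: C_def)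
  have "{c. E u c} \<union> {c. E v c} = V - {u, v}"
  proof (intro equalityI subsetI)
    fix x assume "x \<in> {c. E u c} \<union> {c. E v c}"
    then show "x \<in> V - {u, v}" using E_V[of u x] E_V[of v x] uv(4,5) by auto
  next
    fix x assume "x \<in> V - {u, v}"
    then show "x \<in> {c. E u c} \<union> {c. E v c}" using dom[of x] E_sym[of x u] E_sym[of x v] by auto
  qed
  then have "d u + d v = card (V - {u, v}) + card C"
    unfolding degree_eq C_def using card_Un_Int[of "{c. E u c}" "{c. E v c}"] by (simp add: Collect_conj_eq)
  also have "card (V - {u, v}) = card V - 2" using uv by (simp add: card_Diff_subset)
  finally have "card C \<le> 2" using light_degree[OF uv(1)] light_degree[OF uv(2)] card_V by linarith
  have degw: "card V \<le> d c + card C \<and> (c' \<in> C \<longrightarrow> E c c' \<longrightarrow> card V + 1 \<le> d c + card C)" if c: "c \<in> C" for c c'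
  proof -
    have cr: "cross c u v" using c uv by (auto simp: cross_def C_def intro: E_sym)
    have sub: "V - C \<subseteq> {x. E c x}"
    proof
      fix x assume x: "x \<in> V - C"
      show "x \<in> {x. E c x}"
      proof (cases "x = u \<or> x = v")
        case True
        then show ?thesis using cr by (auto simp: cross_def)
      next
        case False
        then consider "E x u" "\<not> E x v" | "E x v" "\<not> E x u" using x dom E_sym by (auto simp: C_def)
        then show ?thesis
          using cross_nbr_of_end[OF cr, of x] cross_nbr_of_end[OF cross_sym[OF cr], of x] x c E_sym by (cases; auto)
      qed
    qed
    have CV: "C \<subseteq> V" using E_V by (auto simp: C_def)
    have "card (V - C) = card V - card C" using CV fC by (simp add: card_Diff_subset)
    moreover have "card (V - C) \<le> d c" unfolding degree_eq using sub by (intro card_mono) auto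
    moreover have "card (insert c' (V - C)) \<le> d c" if "c' \<in> C" "E c c'"
      unfolding degree_eq using sub that by (intro card_mono) auto
    moreover have "card (insert c' (V - C)) = Suc (card (V - C))" if "c' \<in> C" using that by simp
    moreover have "card C \<le> card V" using CV by (simp add: card_mono)
    ultimately show ?thesis by auto
  qed
  obtain xs where h: "ham xs" using ham_ex by blast
  obtain p where p: "nxt xs p w" using prev_exists[OF h uv(10)] .
  obtain q where q: "nxt xs w q" using nxt_exists[OF h uv(10)] .
  have pq: "p \<noteq> q" "E p w" "E w q" "p \<in> V" "q \<in> V" using prev_neq_next[OF h p q] nxt_E[OF h] nxt_V[OF h] p q by auto
  have dpq: "2 \<le> d p" "2 \<le> d q" "d p + d w \<le> card V" "d q + d w \<le> card V"
    using degree_ge_2[OF h] pq stuck_nxt[OF h p] stuck_nxt[OF h q] by auto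
  have wC': "card V \<le> d w + card C" "\<And>c'. c' \<in> C \<Longrightarrow> \<not> E w c'"
    using degw[OF wC] dpq \<open>card C \<le> 2\<close> by force+
  then have "card C = 2" using dpq \<open>card C \<le> 2\<close> by linarith
  then obtain w' where w': "C = {w, w'}" "w' \<noteq> w" using wC by (auto simp: card_2_iff)
  \<comment> \<open>Any other neighbour of \<open>w\<close> would be adjacent to \<open>w\<close>,
    to \<open>w'\<close> and to one of \<open>u\<close>, \<open>v\<close>, hence of degree at least
    3.\<close>
  have small: "r = u \<or> r = v" if r: "E w r" "d r \<le> 2" for r
  proof (rule ccontr)
    assume nr: "\<not> ?thesis"
    have rC: "r \<notin> C" using wC' r by blast
    then obtain s where s: "E r s" "s = u \<or> s = v"
      using cross_nbr[OF w r(1)] nr by blast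
    have "cross w' u v" using w' uv by (auto simp: cross_def C_def intro: E_sym)
    moreover have "\<not> (E r u \<and> E r v)" using rC E_sym by (auto simp: C_def)
    moreover have "r \<noteq> w'" using rC w' by blast
    ultimately have "E r w'"
      using cross_nbr_of_end[of w' u v r] cross_nbr_of_end[of w' v u r] cross_sym[of w' u v] s by metis
    then have "{s, w, w'} \<subseteq> {y. E r y}" using s(1) E_sym[OF r(1)] by simp
    then have "card {s, w, w'} \<le> d r" unfolding degree_eq by (intro card_mono) auto
    moreover have "w \<in> C" "w' \<in> C" using w'(1) by simp_all
    then have "s \<noteq> w" "s \<noteq> w'" using s(2) E_irrefl[of u] E_irrefl[of v] unfolding C_def by blast+
    then have "card {s, w, w'} = 3" using w'(2) by simp
    ultimately show False using r by simp
  qed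
  have "{p, q} = {u, v}" using small[of p] small[of q] pq E_sym dpq wC' \<open>card C = 2\<close> by force
  then have duv: "d u \<le> 2" "d v \<le> 2" using dpq wC' \<open>card C = 2\<close> by (auto simp: doubleton_eq_iff)
  have nb: "{y. E x y} = C" if "x = u \<or> x = v" for x
  proof (rule card_seteq[symmetric])
    show "C \<subseteq> {y. E x y}" using that by (auto simp: C_def)
    show "card {y. E x y} \<le> card C" using duv that \<open>card C = 2\<close> by (auto simp: degree_eq)
  qed simp
  have V: "V = {u, w, v, w'}"
  proof
    show "V \<subseteq> {u, w, v, w'}" using dom nb[of u] nb[of v] w' E_sym by blast
    show "{u, w, v, w'} \<subseteq> V" using uv w' E_V[of u] by (auto simp: C_def)
  qed
  have uw': "E u w'" "E v w'" "w' \<noteq> u" "w' \<noteq> v" using w' uv by (auto simp: C_def)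
  define L where "L = [u, w, v, w']"
  have "is_cycle V E L"
    using uv uw' w' V by (auto simp: L_def is_cycle_iff intro: E_sym)
  moreover have "cycle_edge L x y" if "E x y" for x y
  proof -
    have i: "cycle_edge L u w" "cycle_edge L w v" "cycle_edge L v w'" "cycle_edge L w' u"
      unfolding cycle_edge_def L_def
      by (rule exI[of _ 0], simp) (rule exI[of _ 1], simp, rule exI[of _ 2], simp, rule exI[of _ 3], simp)
    have s: "cycle_edge L b a" if "cycle_edge L a b" for a b
      using that by (simp add: cycle_edge_def insert_commute)
    have "\<not> E w w'" "\<not> E w' w" using wC' w' E_sym by auto
    moreover have "x \<in> V" "y \<in> V" using that E_V by auto
    ultimately show ?thesis using that i s uv V by auto
  qed
  ultimately show ?thesis unfolding is_cycle_graph_def using V by (intro exI[of _ L]) (auto simp: L_def)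
qed

lemma exit_light_class:
  assumes h: "ham xs" and U: "\<And>x. x \<in> U \<Longrightarrow> light x" "\<And>x y. x \<in> U \<Longrightarrow> light y \<Longrightarrow> E x y \<Longrightarrow> y \<in> U"
    and a: "a \<in> U" and b: "light b" "b \<notin> U"
  obtains p z q where "nxt xs p z" "nxt xs z q" "p \<in> U" "heavy z" "light q" "q \<notin> U"
proof -
  \<comment> \<open>Heavy vertices reached from \<open>U\<close> count as inside. The edge leaving
    \<open>P\<close> then starts at such a vertex: the successor of a vertex of \<open>U\<close>
    lies in \<open>U\<close> if light and satisfies \<open>P\<close> if heavy. The end of the edge
    is light because no two heavy vertices are consecutive.\<close>
  define P where "P x \<longleftrightarrow> x \<in> U \<or> (heavy x \<and> (\<exists>p\<in>U. nxt xs p x))" for x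
  have "P a" "\<not> P b" using a b(2) b(1)[unfolded light_def] by (simp_all add: P_def)
  moreover have "a \<in> V" "b \<in> V" using light_V U(1)[OF a] b(1) by simp_all
  ultimately obtain z q where zq: "nxt xs z q" "P z" "\<not> P q" using exit_edge[OF h, of a P b] by metis
  have qV: "q \<in> V" using nxt_V[OF h zq(1)] by simp
  have "z \<notin> U"
  proof
    assume "z \<in> U"
    then have "\<not> heavy q" "q \<notin> U" using zq unfolding P_def by blast+
    then show False using U(2)[OF \<open>z \<in> U\<close>, of q] qV nxt_E[OF h zq(1)] by (simp add: light_def)
  qed
  then obtain p where p: "heavy z" "p \<in> U" "nxt xs p z" using zq(2) unfolding P_def by blast
  moreover have "q \<notin> U" using zq(3) unfolding P_def by blast
  ultimately show ?thesis using that[of p z q] zq(1) light_nxt[OF h zq(1)] by simp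
qed

text \<open>Without a crossing the light vertices form a clique \<open>L\<close>: a missing edge
  would give a proper subset closed under light adjacency, which a Hamilton cycle leaves across a
  crossing. If no vertex is heavy, the graph is complete and 2(n - 1) > n. Otherwise successors map
  the heavy vertices injectively into \<open>L\<close>, so |L| >= n/2; the successor of a heavy
  \<open>x\<close> is adjacent to \<open>x\<close> and to the rest of \<open>L\<close>, so its
  degree and that of \<open>x\<close> sum to more than n.\<close>

lemma cross_exists: "\<exists>w u v. cross w u v"
proof (rule ccontr)
  assume no: "\<not> ?thesis"
  obtain xs where h: "ham xs" using ham_ex by blast
  have clique: "E a b" if ab: "light a" "light b" "a \<noteq> b" for a b
  proof (rule ccontr)
    assume nE: "\<not> E a b"
    define U where "U = {x. light x \<and> (x = a \<or> E x a)}"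
    have cl: "y \<in> U" if "x \<in> U" "light y" "E x y" for x y
    proof (cases "x = a \<or> y = a")
      case True
      then show ?thesis using that E_sym by (auto simp: U_def)
    next
      case False
      moreover have "\<not> cross x y a" using no by blast
      ultimately show ?thesis using that ab by (auto simp: U_def cross_def)
    qed
    obtain p z q where pz: "nxt xs p z" "nxt xs z q" "p \<in> U" "heavy z" "light q" "q \<notin> U"
    proof (rule exit_light_class[OF h, of U a b])
      show "\<And>x. x \<in> U \<Longrightarrow> light x" by (simp add: U_def)
      show "b \<notin> U" using nE ab E_sym by (auto simp: U_def)
    qed (use ab cl in \<open>auto simp: U_def\<close>)
    have "E z p" "E z q" using nxt_E[OF h pz(1)] nxt_E[OF h pz(2)] by (auto intro: E_sym)
    moreover have "light p" "p \<noteq> q" "\<not> E p q" using pz(3,5,6) cl[of p q] by (auto simp: U_def)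
    ultimately have "cross z p q" using pz(5) by (simp add: cross_def)
    then show False using no by blast
  qed
  define L where "L = {x. light x}"
  define H where "H = {x. heavy x}"
  have LH: "L \<union> H = V" "L \<inter> H = {}" "finite L" "finite H"
    using light_V heavy_V by (auto simp: L_def H_def light_def intro: finite_subset[OF _ fin])
  then have n: "card V = card L + card H" by (metis card_Un_disjoint)
  have cl: "L - {l} \<subseteq> {y. E l y}" if "l \<in> L" for l using clique that by (auto simp: L_def)
  show False
  proof (cases "H = {}")
    case True
    obtain a where a: "a \<in> V" using card_V by fastforce
    obtain b where b: "nxt xs a b" using nxt_exists[OF h a] .
    have "card V - 1 \<le> d x" if "x \<in> V" for x
    proof -
      have "card (V - {x}) \<le> d x" unfolding degree_eq using cl[of x] True LH that by (intro card_mono) auto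
      then show ?thesis using that by simp
    qed
    from this[of a] this[of b] stuck_nxt[OF h b] nxt_V[OF h b] card_V show False by linarith
  next
    case False
    then obtain x where x: "x \<in> H" by blast
    define s where "s x = (SOME y. nxt xs x y)" for x
    have s: "nxt xs x (s x)" if "x \<in> V" for x
      unfolding s_def using nxt_exists[OF h that] by (metis someI)
    have HV: "H \<subseteq> V" using LH by auto
    have "inj_on s H" using s HV prev_unique[OF h] by (metis inj_onI subsetD)
    moreover have sL: "s ` H \<subseteq> L" using s HV light_nxt[OF h] by (fastforce simp: L_def H_def)
    ultimately have le: "card H \<le> card L" using LH by (metis card_inj_on_le)
    have l: "s x \<in> L" "nxt xs x (s x)" using sL x s HV by auto
    have "insert x (L - {s x}) \<subseteq> {y. E (s x) y}" using cl[OF l(1)] nxt_E[OF h l(2)] E_sym by auto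
    then have "card (insert x (L - {s x})) \<le> d (s x)" unfolding degree_eq by (intro card_mono) auto
    moreover have "card L > 0" using l(1) LH(3) card_gt_0_iff by blast
    then have "card (insert x (L - {s x})) = card L" using x l(1) LH
      by (subst card_insert_disjoint) auto
    ultimately have "2 * card L + (card V + 1) \<le> 2 * card V"
      using stuck_nxt[OF h l(2)] x by (auto simp: H_def heavy_def)
    then show False using le n by linarith
  qed
qed

end

section \<open>Classes of light vertices\<close>

text \<open>With \<open>dominated_pair_cycle_graph\<close> this is what excluding the cycle
  provides: the ends of a crossing never dominate the graph.\<close>

locale far_stuck_graph = stuck_graph +
  assumes far: "cross w u v \<Longrightarrow> \<exists>y\<in>V. y \<noteq> u \<and> y \<noteq> v \<and> \<not> E y u \<and> \<not> E y v"
begin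

lemma far_not_adjacent:
  assumes "cross w u v" "y \<noteq> u" "y \<noteq> v" "\<not> E y u" "\<not> E y v" shows "\<not> E w y"
  using cross_nbr[OF assms(1), of y] assms E_sym by blast

lemma far_edge_heavy:
  assumes w: "cross w u v" and y: "y \<noteq> u" "y \<noteq> v" "\<not> E y u" "\<not> E y v"
    and p: "E p y" "E p u"
  shows "heavy p \<and> (heavy w \<or> heavy y)"
proof -
  have wy: "\<not> E w y" by (rule far_not_adjacent[OF w y])
  have "\<not> E p v"
  proof
    assume "E p v"
    then have "cross p u v" using w p by (simp add: cross_def)
    then show False using far_not_adjacent[OF _ y] p by blast
  qed
  moreover have "p \<noteq> w" using wy p by blast
  ultimately have pw: "E p w" using cross_nbr_of_end[OF w p(2)] by blast
  have f: "E v w" "E w p" "\<not> E v p" "v \<noteq> p" "w \<noteq> y" "\<not> E v y" "\<not> heavy v" "w \<noteq> v"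
    using w pw \<open>\<not> E p v\<close> y p E_sym by (auto simp: cross_def light_def)
  have "heavy p" using P4[of v w p y] f wy p y by blast
  moreover have "heavy w \<or> heavy y" using P4[of y p w v] f wy p y E_sym by blast
  ultimately show ?thesis by blast
qed

text \<open>A Hamilton cycle leaves the closed neighbourhood of \<open>u\<close> and
  \<open>v\<close> along some edge p q. By \<open>far_edge_heavy\<close> its start is heavy, and if
  \<open>w\<close> were light its end would be heavy too.\<close>

lemma cross_heavy:
  assumes w: "cross w u v" shows "heavy w"
proof (rule ccontr)
  assume nw: "\<not> heavy w"
  obtain xs where h: "ham xs" using ham_ex by blast
  define P where "P x \<longleftrightarrow> x = u \<or> x = v \<or> E x u \<or> E x v" for x
  obtain y where y: "y \<in> V" "\<not> P y" using far[OF w] by (auto simp: P_def)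
  have u: "u \<in> V" "P u" using w light_V by (auto simp: cross_def P_def)
  obtain p q where pq: "nxt xs p q" "P p" "\<not> P q" using exit_edge[OF h u y] .
  have q: "q \<noteq> u" "q \<noteq> v" "\<not> E q u" "\<not> E q v" using pq(3) by (auto simp: P_def)
  have Epq: "E p q" using nxt_E[OF h pq(1)] .
  then have "p \<noteq> u" "p \<noteq> v" using q E_sym by blast+
  then have "E p u \<or> E p v" using pq(2) by (auto simp: P_def)
  then have "heavy p \<and> (heavy w \<or> heavy q)"
    using far_edge_heavy[OF w q Epq] far_edge_heavy[OF cross_sym[OF w] q(2,1,4,3) Epq] by blast
  then show False using not_both_heavy[OF h pq(1)] nw by blast
qed

lemma light_trans:
  assumes "light a" "light b" "light c" "E a b" "E b c" "a \<noteq> c" shows "E a c"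
proof (rule ccontr)
  assume "\<not> E a c"
  then have "cross b a c" using assms E_sym by (auto simp: cross_def)
  then show False using cross_heavy assms(2) by (auto simp: light_def)
qed

section \<open>Light classes and the crossings between them\<close>

definition sim :: "'a \<Rightarrow> 'a \<Rightarrow> bool" where
  "sim x u \<longleftrightarrow> light x \<and> light u \<and> (x = u \<or> E x u)"

lemma sim_refl: "light x \<Longrightarrow> sim x x" by (simp add: sim_def)
lemma sim_sym: "sim x y \<Longrightarrow> sim y x" using E_sym by (auto simp: sim_def)
lemma sim_trans: "sim x y \<Longrightarrow> sim y z \<Longrightarrow> sim x z" using light_trans by (auto simp: sim_def)
lemma sim_light: "sim x y \<Longrightarrow> light x \<and> light y" by (simp add: sim_def)
lemma sim_E: "sim x y \<Longrightarrow> x \<noteq> y \<Longrightarrow> E x y" by (simp add: sim_def)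

lemma cross_not_sim: "cross w u v \<Longrightarrow> \<not> sim u v"
  by (auto simp: cross_def sim_def)

lemma crossI: "light u \<Longrightarrow> light v \<Longrightarrow> \<not> sim u v \<Longrightarrow> E w u \<Longrightarrow> E w v \<Longrightarrow> cross w u v"
  by (auto simp: cross_def sim_def)

lemma cross_light: "cross w u v \<Longrightarrow> light u \<and> light v \<and> E w u \<and> E w v"
  by (simp add: cross_def)

text \<open>By \<open>cross_nbr_of_end\<close> a crossing vertex is adjacent to the whole class of
  each end, so crossings join classes rather than single vertices. By \<open>claw\<close> it has no
  neighbour in a third class (\<open>cross_light_nbr\<close>).\<close>

lemma cross_sim1: assumes w: "cross w u v" and s: "sim u' u" shows "cross w u' v"
proof -
  have ns: "\<not> sim u' v" using cross_not_sim[OF w] s sim_sym sim_trans by blast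
  have "E w u'"
  proof (cases "u' = u")
    case False
    then have "E u' u" using s by (simp add: sim_def)
    moreover have "u' \<noteq> w" using cross_heavy[OF w] s by (auto simp: sim_def light_def)
    moreover have "\<not> E u' v" using ns s w by (auto simp: sim_def cross_def)
    ultimately show ?thesis using cross_nbr_of_end[OF w] E_sym by blast
  qed (use w in \<open>simp add: cross_def\<close>)
  then show ?thesis using ns w s by (intro crossI) (auto simp: cross_def sim_def)
qed

lemma cross_sim: "cross w u v \<Longrightarrow> sim u' u \<Longrightarrow> sim v' v \<Longrightarrow> cross w u' v'"
  using cross_sim1 cross_sym by blast

lemma cross_light_nbr: "cross w u v \<Longrightarrow> E w p \<Longrightarrow> light p \<Longrightarrow> sim p u \<or> sim p v"
  using cross_nbr[of w u v p] by (auto simp: cross_def sim_def)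

text \<open>If the far vertex is heavy, its successor on a Hamilton cycle serves instead: it is
  light, and adjacency to \<open>u\<close> or \<open>v\<close> would make it heavy by
  \<open>far_edge_heavy\<close>.\<close>

lemma far_light:
  assumes w: "cross w u v" obtains y where "light y" "\<not> sim y u" "\<not> sim y v"
proof -
  obtain y where y: "y \<in> V" "y \<noteq> u" "y \<noteq> v" "\<not> E y u" "\<not> E y v" using far[OF w] by blast
  show ?thesis
  proof (cases "light y")
    case True
    then show ?thesis using that[of y] y by (simp add: sim_def)
  next
    case False
    then have hy: "heavy y" using y by (simp add: light_def)
    obtain xs where h: "ham xs" using ham_ex by blast
    obtain q where q: "nxt xs y q" using nxt_exists[OF h y(1)] .
    have lq: "light q" using light_nxt[OF h q hy] .
    have Eq: "E q y" using nxt_E[OF h q] E_sym by blast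
    have "q \<noteq> u" "q \<noteq> v" using Eq y E_sym by blast+
    moreover have "\<not> E q u" "\<not> E q v"
      using far_edge_heavy[OF w y(2-5) Eq] far_edge_heavy[OF cross_sym[OF w] y(3,2,5,4) Eq] lq
      by (auto simp: light_def)
    ultimately show ?thesis using that[of q] lq by (simp add: sim_def)
  qed
qed

text \<open>With \<open>u\<close> and \<open>v\<close> equal this describes the exit from a single
  class.\<close>

lemma exit_sim:
  assumes h: "ham xs" and U: "light u" "light v" and b: "light b" "\<not> sim b u" "\<not> sim b v"
  obtains p z q where "nxt xs p z" "nxt xs z q" "sim p u \<or> sim p v" "cross z p q" "\<not> sim q u" "\<not> sim q v"
proof -
  define C where "C = {x. sim x u \<or> sim x v}"
  obtain p z q where pz: "nxt xs p z" "nxt xs z q" "p \<in> C" "heavy z" "light q" "q \<notin> C"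
  proof (rule exit_light_class[OF h, of C u b])
    show "light x" if "x \<in> C" for x using that sim_light by (auto simp: C_def)
    show "y \<in> C" if "x \<in> C" "light y" "E x y" for x y
    proof -
      have "light x" using that(1) sim_light by (auto simp: C_def)
      then have "sim y x" using that(2) E_sym[OF that(3)] by (simp add: sim_def)
      then show ?thesis using that(1) sim_trans by (auto simp: C_def)
    qed
  qed (use U b in \<open>auto simp: C_def sim_refl\<close>)
  have p: "sim p u \<or> sim p v" and q: "\<not> sim q u" "\<not> sim q v" using pz(3,6) by (simp_all add: C_def)
  have "\<not> sim p q" using p q sim_trans sim_sym by blast
  then have "cross z p q"
    using crossI[of p q z] pz(5) p sim_light E_sym[OF nxt_E[OF h pz(1)]] nxt_E[OF h pz(2)] by blast
  then show ?thesis using that[of p z q] pz(1,2) p q by blast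
qed

text \<open>As \<open>z\<close> has no neighbour in the class of \<open>v\<close>, a third class for
  it, \<open>P4\<close> along v, w, u, z forces the edge.\<close>

lemma cross_adjacent:
  assumes w: "cross w u v" and z: "cross z u y" and vy: "\<not> sim v y" shows "E w z"
proof -
  have l: "light u" "light v" "light y" using w z by (auto simp: cross_def)
  have "\<not> sim v u" "\<not> sim y u" using cross_not_sim[OF w] cross_not_sim[OF z] sim_sym by blast+
  then have "\<not> E z v" "\<not> E w y" using cross_light_nbr[OF z, of v] cross_light_nbr[OF w, of y] l vy sim_sym by blast+
  moreover have "z \<noteq> w" using calculation z by (auto simp: cross_def)
  ultimately show ?thesis using cross_nbr_of_end[OF w, of z] z E_sym by (auto simp: cross_def)
qed

text \<open>If both cycle neighbours of \<open>w\<close> were in one class, they would be adjacent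
  and \<open>w\<close> could be taken out. The cycle leaves the two classes at some crossing
  \<open>z\<close>, and \<open>w\<close> is adjacent both to \<open>z\<close> and to its
  predecessor, so it could be reinserted there, next to the heavy \<open>z\<close>.\<close>

lemma cross_passes:
  assumes h: "ham xs" and w: "cross w u v" and pq: "nxt xs p w" "nxt xs w q"
  shows "sim p u \<and> sim q v \<or> sim p v \<and> sim q u"
proof -
  have hw: "heavy w" using cross_heavy[OF w] .
  have E: "E w p" "E w q" using nxt_E[OF h pq(1)] nxt_E[OF h pq(2)] E_sym by blast+
  have l: "light p" "light q" using light_prev[OF h pq(1) hw] light_nxt[OF h pq(2) hw] .
  have cl: "sim p u \<or> sim p v" "sim q u \<or> sim q v"
    using cross_light_nbr[OF w] E l by blast+
  have luv: "light u" "light v" using w by (auto simp: cross_def)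
  have "\<not> sim p q"
  proof
    assume "sim p q"
    then have Epq: "E p q" using prev_neq_next[OF h pq] by (simp add: sim_def)
    obtain y where y: "light y" "\<not> sim y u" "\<not> sim y v" using far_light[OF w] .
    obtain p' z q' where z: "nxt xs p' z" "nxt xs z q'" "sim p' u \<or> sim p' v" "cross z p' q'"
      "\<not> sim q' u" "\<not> sim q' v" using exit_sim[OF h luv y] .
    have wz: "E w z" "E w p'"
    proof -
      have "cross w p' v" "\<not> sim v q'" if "sim p' u"
        using cross_sim1[OF w that] z(6) sim_sym by blast+
      moreover have "cross w p' u" "\<not> sim u q'" if "sim p' v"
        using cross_sim1[OF cross_sym[OF w] that] z(5) sim_sym by blast+
      ultimately show "E w z" "E w p'" using cross_adjacent[OF _ z(4)] z(3) by (auto simp: cross_def)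
    qed
    show False
      by (rule no_insertion'[OF h hw pq Epq cross_heavy[OF z(4)] _ z(1)]) (use wz E_sym in blast)+
  qed
  then show ?thesis using cl sim_sym sim_trans by blast
qed

section \<open>Directions in which crossings are traversed\<close>

definition enters :: "'a list \<Rightarrow> 'a \<Rightarrow> 'a \<Rightarrow> bool" where
  "enters xs w u \<longleftrightarrow> (\<exists>q. nxt xs w q \<and> sim q u)"

lemma not_enters:
  assumes h: "ham xs" and w: "cross w u v" and n: "\<not> enters xs w u" and p: "nxt xs p w"
  shows "sim p u"
proof -
  have "w \<in> V" using nxt_V[OF h p] by simp
  then obtain q where "nxt xs w q" using nxt_exists[OF h] by blast
  then show ?thesis using cross_passes[OF h w p] n by (auto simp: enters_def)
qed

lemma enters_prev:
  assumes h: "ham xs" and w: "cross w u v" and e: "enters xs w u" and p: "nxt xs p w"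
  shows "sim p v"
proof -
  obtain q where "nxt xs w q" "sim q u" using e by (auto simp: enters_def)
  then show ?thesis using cross_passes[OF h w p] cross_not_sim[OF w] sim_sym sim_trans by blast
qed

lemma enters_rev:
  assumes h: "ham xs" and w: "cross w u v" shows "enters (rev xs) w u \<longleftrightarrow> \<not> enters xs w u"
proof -
  have "w \<in> V" using cross_heavy[OF w] heavy_V by blast
  then obtain p where p: "nxt xs p w" using prev_exists[OF h] by blast
  show ?thesis
  proof
    assume "enters (rev xs) w u"
    then have "sim p u" using p prev_unique[OF h] by (auto simp: enters_def nxt_rev)
    then show "\<not> enters xs w u"
      using enters_prev[OF h w _ p] cross_not_sim[OF w] sim_sym sim_trans by blast
  next
    assume "\<not> enters xs w u"
    then show "enters (rev xs) w u" using not_enters[OF h w _ p] p by (auto simp: enters_def nxt_rev)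
  qed
qed

text \<open>The heavy vertices \<open>w\<close> and \<open>z\<close> are adjacent. If both entered
  the class of \<open>u\<close>, their successors would be two adjacent members of it, against
  \<open>nxt_heavy_not_adjacent\<close>; if both left it, the same holds for their
  predecessors.\<close>

lemma orientation:
  assumes h: "ham xs" and w: "cross w u v" and z: "cross z u y" and vy: "\<not> sim v y"
  shows "enters xs w u \<longleftrightarrow> \<not> enters xs z u"
proof -
  have wz: "E w z" "w \<noteq> z" using cross_adjacent[OF w z vy] E_neq by blast+
  have hv: "heavy w" "heavy z" using cross_heavy w z by blast+
  obtain p where p: "nxt xs p w" using prev_exists[OF h heavy_V[OF hv(1)]] .
  obtain p' where p': "nxt xs p' z" using prev_exists[OF h heavy_V[OF hv(2)]] .
  have "\<not> (enters xs w u \<and> enters xs z u)"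
  proof
    assume "enters xs w u \<and> enters xs z u"
    then obtain q q' where q: "nxt xs w q" "nxt xs z q'" "sim q u" "sim q' u" by (auto simp: enters_def)
    have "sim q q'" using q sim_sym sim_trans by blast
    moreover have "q \<noteq> q'" using q prev_unique[OF h] wz by blast
    ultimately show False using nxt_heavy_not_adjacent[OF h hv wz(1) q(1,2)] sim_E by blast
  qed
  moreover have "enters xs w u \<or> enters xs z u"
  proof (rule ccontr)
    assume "\<not> ?thesis"
    then have "sim p u" "sim p' u" using not_enters[OF h w _ p] not_enters[OF h z _ p'] by blast+
    then have "sim p p'" using sim_sym sim_trans by blast
    moreover have "p \<noteq> p'" using p p' nxt_unique[OF h] wz by blast
    ultimately show False using prev_heavy_not_adjacent[OF h hv wz(1) p p'] sim_E by blast
  qed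
  ultimately show ?thesis by blast
qed

text \<open>By \<open>orientation\<close> three crossings would have pairwise opposite directions,
  but there are only two directions.\<close>

lemma no_three_partners:
  assumes "cross w u v" "cross z u y" "cross x u t" "\<not> sim v y" "\<not> sim v t" "\<not> sim y t"
  shows False
proof -
  obtain xs where h: "ham xs" using ham_ex by blast
  show False using orientation[OF h assms(1,2,4)] orientation[OF h assms(1,3,5)] orientation[OF h assms(2,3,6)] by blast
qed

text \<open>The exit from a class for a segment of the cycle. It delivers the splitting itself,
  along which the cycle is recut later. The induction is on the length because a heavy vertex
  between two members of the class is skipped together with its predecessor.\<close>

lemma segment_exit:
  assumes "successively (\<lambda>a b. E a b \<and> \<not> (heavy a \<and> heavy b)) L" "L \<noteq> []" "set L \<subseteq> V"
    "sim (hd L) u" "light (last L)" "\<not> sim (last L) u"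
  shows "\<exists>A z B. L = A @ z # B \<and> A \<noteq> [] \<and> B \<noteq> [] \<and> sim (last A) u \<and> heavy z \<and> light (hd B) \<and> \<not> sim (hd B) u"
  using assms
proof (induction L rule: length_induct)
  case (1 L)
  then obtain a L' where L: "L = a # L'" by (cases L) auto
  then have "L' \<noteq> []" using 1 by auto
  then obtain b M where L': "L' = b # M" by (cases L') auto
  have ab: "E a b" "\<not> (heavy a \<and> heavy b)" "b \<in> V" "sim a u" using 1 L L' by auto
  show ?case
  proof (cases "light b")
    case True
    then have "sim b a" using sim_light[OF ab(4)] E_sym[OF ab(1)] by (simp add: sim_def)
    then have "sim b u" using sim_trans ab(4) by blast
    moreover have "\<exists>A z B. L' = A @ z # B \<and> A \<noteq> [] \<and> B \<noteq> [] \<and> sim (last A) u \<and> heavy z \<and> light (hd B) \<and> \<not> sim (hd B) u"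
      using 1 L L' calculation by auto
    then obtain A z B where "L' = A @ z # B" "A \<noteq> []" "B \<noteq> []" "sim (last A) u" "heavy z" "light (hd B)" "\<not> sim (hd B) u"
      by blast
    then show ?thesis using L by (intro exI[of _ "a # A"] exI[of _ z] exI[of _ B]) auto
  next
    case False
    then have hb: "heavy b" using ab by (simp add: light_def)
    have M: "M \<noteq> []" using 1 L L' False by auto
    then have hM: "light (hd M)" using 1 L L' hb hd_in_set[OF M] by (auto simp: successively_Cons light_def)
    show ?thesis
    proof (cases "sim (hd M) u")
      case False
      then show ?thesis using L L' M hM hb ab by (intro exI[of _ "[a]"] exI[of _ b] exI[of _ M]) auto
    next
      case True
      then have "\<exists>A z B. M = A @ z # B \<and> A \<noteq> [] \<and> B \<noteq> [] \<and> sim (last A) u \<and> heavy z \<and> light (hd B) \<and> \<not> sim (hd B) u"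
        using 1 L L' M by (auto simp: successively_Cons)
      then obtain A z B where "M = A @ z # B" "A \<noteq> []" "B \<noteq> []" "sim (last A) u" "heavy z" "light (hd B)" "\<not> sim (hd B) u"
        by blast
      then show ?thesis using L L' by (intro exI[of _ "a # b # A"] exI[of _ z] exI[of _ B]) auto
    qed
  qed
qed

lemma ham_steps:
  assumes h: "ham (as @ bs @ cs)"
  shows "successively (\<lambda>a b. E a b \<and> \<not> (heavy a \<and> heavy b)) bs"
  unfolding successively_conv_nth
proof (intro allI impI)
  fix i assume i: "Suc i < length bs"
  then have "bs = take i bs @ bs ! i # bs ! Suc i # drop (Suc (Suc i)) bs"
    by (metis Cons_nth_drop_Suc Suc_lessD append_take_drop_id)
  then have "as @ bs @ cs = (as @ take i bs) @ bs ! i # bs ! Suc i # (drop (Suc (Suc i)) bs @ cs)"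
    by (metis append.assoc append_Cons)
  then have "nxt (as @ bs @ cs) (bs ! i) (bs ! Suc i)" using nxt_append by metis
  then show "E (bs ! i) (bs ! Suc i) \<and> \<not> (heavy (bs ! i) \<and> heavy (bs ! Suc i))"
    using nxt_E[OF h] not_both_heavy[OF h] by blast
qed

text \<open>If two heavy vertices entered the class of \<open>u\<close> from the class of \<open>v\<close>, the two traversals of
  the class of \<open>u\<close> could be merged, which puts \<open>w\<close> next to the exit of the first one.\<close>
lemma cross_unique_aux:
  assumes h: "ham xs" and w: "cross w u v" "cross w' u v" and z: "cross z u y" and vy: "\<not> sim v y"
    and e: "enters xs w u"
  shows "w = w'"
proof (rule ccontr)
  assume ne: "w \<noteq> w'"
  \<comment> \<open>Every crossing between \<open>u\<close> and \<open>v\<close> is opposite to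
    \<open>z\<close> in direction, so all of them agree with each other.\<close>
  have e': "enters xs w' u" using orientation[OF h w(1) z vy] orientation[OF h w(2) z vy] e by blast
  have hw: "heavy w" "heavy w'" using cross_heavy w by blast+
  obtain R where R: "ham (w # R)" "nxt (w # R) = nxt xs" using ham_rotate_to[OF h heavy_V[OF hw(1)]] .
  have "w' \<in> set R" using R(1) heavy_V[OF hw(2)] ne by (auto simp: ham_def)
  then obtain R1 R2 where R12: "R = R1 @ w' # R2" by (meson split_list)
  have R1: "R1 \<noteq> []" using no_heavy_start[of w w' R2] R(1) R12 hw by auto
  have R2: "R2 \<noteq> []"
  proof
    assume "R2 = []"
    then have "nxt xs w' w" using nxt_last[of "w # R"] R(2) R12 by simp
    then show False using not_both_heavy h hw by blast
  qed
  have n: "nxt xs w (hd R1)" "nxt xs (last R1) w'" "nxt xs w' (hd R2)" "nxt xs (last R2) w"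
  proof -
    show "nxt xs w (hd R1)" using R1 R(2) R12 nxt_Cons[of w "hd R1" "tl R1 @ w' # R2"] by (cases R1) auto
    have "w # R = (w # butlast R1) @ last R1 # w' # R2" using R12 R1 by simp
    then show "nxt xs (last R1) w'" using R(2) nxt_append by metis
    have "w # R = (w # R1) @ w' # hd R2 # tl R2" using R12 R2 by simp
    then show "nxt xs w' (hd R2)" using R(2) nxt_append by metis
    show "nxt xs (last R2) w" using nxt_last[of "w # R"] R(2) R12 R2 by simp
  qed
  have h1: "sim (hd R1) u" using e n(1) nxt_unique[OF h] by (auto simp: enters_def)
  have h2: "sim (hd R2) u" using e' n(3) nxt_unique[OF h] by (auto simp: enters_def)
  have l1: "sim (last R1) v" using enters_prev[OF h w(2) e' n(2)] .
  have l2: "sim (last R2) v" using enters_prev[OF h w(1) e n(4)] .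
  have nu: "\<not> sim a u" if "sim a v" for a using that cross_not_sim[OF w(1)] sim_sym sim_trans by blast
  have RV: "set R1 \<subseteq> V" "set R2 \<subseteq> V" using R(1) R12 by (auto simp: ham_def)
  have s1: "successively (\<lambda>a b. E a b \<and> \<not> (heavy a \<and> heavy b)) R1"
    using ham_steps[of "[w]" R1 "w' # R2"] R(1) R12 by simp
  have s2: "successively (\<lambda>a b. E a b \<and> \<not> (heavy a \<and> heavy b)) R2"
    using ham_steps[of "w # R1 @ [w']" R2 "[]"] R(1) R12 by simp
  obtain A1 z1 B1 where 1: "R1 = A1 @ z1 # B1" "A1 \<noteq> []" "B1 \<noteq> []" "sim (last A1) u" "heavy z1"
    "light (hd B1)" "\<not> sim (hd B1) u"
    using segment_exit[OF s1 R1 RV(1) h1] l1 nu sim_light by blast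
  obtain A2 z2 B2 where 2: "R2 = A2 @ z2 # B2" "A2 \<noteq> []" "B2 \<noteq> []" "sim (last A2) u" "heavy z2"
    "light (hd B2)" "\<not> sim (hd B2) u"
    using segment_exit[OF s2 R2 RV(2) h2] l2 nu sim_light by blast
  have cyc: "is_cycle V E (w # A1 @ z1 # B1 @ w' # A2 @ z2 # B2)"
    using R(1) R12 1(1) 2(1) by (simp add: ham_def)
  have "E (last A1) z1" "E z1 (hd B1)" "E (last A2) z2" "E z2 (hd B2)"
    using cyc 1(2,3) 2(2,3) by (auto simp: is_cycle_iff successively_append_iff successively_Cons hd_append)
  then have z1: "cross z1 (last A1) (hd B1)" and z2: "cross z2 (last A2) (hd B2)"
    using crossI[of "last A1" "hd B1" z1] crossI[of "last A2" "hd B2" z2]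
      1(4,6,7) 2(4,6,7) sim_light sim_trans sim_sym E_sym by blast+
  have z1u: "cross z1 u (hd B1)" and z2u: "cross z2 u (hd B2)"
    using cross_sim1[OF z1] cross_sim1[OF z2] 1 2 sim_sym by blast+
  \<comment> \<open>If \<open>z1\<close> led into the class of \<open>v\<close>, it would have to
    enter the class of \<open>u\<close> as \<open>w\<close> does, yet it leaves it.\<close>
  have vB1: "\<not> sim v (hd B1)"
  proof
    assume "sim v (hd B1)"
    moreover have "sim u u" using sim_refl cross_light[OF w(1)] by blast
    ultimately have "cross z1 u v" using cross_sim[OF z1u] by blast
    then have "enters xs z1 u" using orientation[OF h _ z vy] w(1) e by blast
    moreover have "w # R = (w # A1) @ z1 # hd B1 # tl B1 @ w' # R2" using R12 1 by simp
    then have "nxt xs z1 (hd B1)" using R(2) nxt_append by metis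
    ultimately show False using 1 nxt_unique[OF h] by (auto simp: enters_def)
  qed
  have E1: "E w z1" using cross_adjacent[OF w(1) z1u vB1] .
  have E2: "E (last A1) z2" using cross_light[OF cross_sim1[OF z2u 1(4)]] E_sym by blast
  have "hd A1 = hd R1" using 1(1,2) by simp
  then have "sim (hd A1) u" using h1 by simp
  then have "sim (last A2) (hd A1)" using 2(4) sim_sym sim_trans by blast
  moreover have "last A2 \<noteq> hd A1"
  proof -
    have "last A2 \<in> set A2" "hd A1 \<in> set A1" using 1(2) 2(2) by simp_all
    with cyc show ?thesis by (force simp: is_cycle_iff)
  qed
  ultimately have E3: "E (last A2) (hd A1)" using sim_E by blast
  \<comment> \<open>The piece \<open>A1\<close> moves from behind \<open>w\<close> to behind
    \<open>A2\<close>. The new edges are w z1, the one joining \<open>A2\<close> to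
    \<open>A1\<close> inside the class, and the one from \<open>A1\<close> to \<open>z2\<close>,
    which sees the whole class.\<close>
  have "is_cycle V E (w # z1 # B1 @ w' # A2 @ A1 @ z2 # B2)"
    using cyc E1 E2 E3 1(2,3) 2(2,3)
    by (auto simp: is_cycle_iff successively_append_iff successively_Cons hd_append)
  moreover have "set (w # z1 # B1 @ w' # A2 @ A1 @ z2 # B2) = V" using R(1) R12 1(1) 2(1) by (auto simp: ham_def)
  ultimately have "ham (w # z1 # B1 @ w' # A2 @ A1 @ z2 # B2)" unfolding ham_def by blast
  then show False using no_heavy_start hw(1) 1(5) by blast
qed

text \<open>There is a third class, so a Hamilton cycle leaves the first two at some crossing; this
  is the \<open>z\<close> that \<open>cross_unique_aux\<close> needs, at one of the two classes.
  Reversing the cycle provides the required direction.\<close>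

lemma cross_unique:
  assumes w: "cross w u v" and w': "cross w' u v"
  shows "w = w'"
proof -
  obtain xs where h: "ham xs" using ham_ex by blast
  have aux: "w = w'" if "cross w u v" "cross w' u v" "cross z u y" "\<not> sim v y" for u v z y
    using cross_unique_aux[OF h that] cross_unique_aux[OF ham_rev[OF h] that] enters_rev[OF h that(1)] by blast
  obtain y where y: "light y" "\<not> sim y u" "\<not> sim y v" using far_light[OF w] .
  have l: "light u" "light v" using w by (auto simp: cross_def)
  obtain p z q where z: "sim p u \<or> sim p v" "cross z p q" "\<not> sim q u" "\<not> sim q v"
    using exit_sim[OF h l y] by metis
  have "\<not> sim v q" "\<not> sim u q" using z sim_sym by blast+
  then show ?thesis
    using aux[OF w w', of z q] aux[OF cross_sym[OF w] cross_sym[OF w'], of z q] cross_sim1[OF z(2)] z(1) sim_sym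
    by blast
qed

text \<open>On a Hamilton cycle oriented so that \<open>w\<close> enters the class of
  \<open>u\<close>, the cycle has to leave this class at some crossing. If that led to the class of
  \<open>v\<close>, it would be \<open>w\<close> by uniqueness, but \<open>w\<close> enters.\<close>

lemma second_partner:
  assumes w: "cross w u v"
  obtains z y where "cross z u y" "\<not> sim y v"
proof -
  obtain xs0 where h0: "ham xs0" using ham_ex by blast
  obtain xs where h: "ham xs" and e: "enters xs w u"
    using h0 ham_rev[OF h0] enters_rev[OF h0 w] by blast
  have l: "light u" "light v" "\<not> sim v u" using w cross_not_sim[OF w] sim_sym by (auto simp: cross_def)
  obtain p z q where z: "nxt xs p z" "nxt xs z q" "sim p u" "cross z p q" "\<not> sim q u"
    using exit_sim[OF h l(1) l(1) l(2) l(3) l(3)] by metis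
  have zu: "cross z u q" using cross_sim1[OF z(4)] z(3) sim_sym by blast
  have "\<not> sim q v"
  proof
    assume "sim q v"
    then have "cross z u v" using cross_sim[OF zu, of u v] l sim_refl sim_sym by blast
    then have "z = w" using cross_unique w by blast
    then show False using e z nxt_unique[OF h] by (auto simp: enters_def)
  qed
  then show ?thesis using that zu by blast
qed

text \<open>The classes of \<open>u\<close> and \<open>v\<close> have further partners y and x. If
  these differ, the crossings t and z are heavy and nonadjacent and so have three common neighbours,
  while partner counts and uniqueness allow only two: \<open>w\<close> and one crossing between x
  and y.\<close>

lemma sun:
  obtains u v y w z t where "cross w u v" "cross z u y" "cross t v y"
proof -
  obtain w u v where w: "cross w u v" using cross_exists by blast
  obtain z y where z: "cross z u y" "\<not> sim y v" using second_partner[OF w] .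
  obtain t x where t: "cross t v x" "\<not> sim x u" using second_partner[OF cross_sym[OF w]] .
  have l: "light u" "light v" "light y" "light x" using w z t by (auto simp: cross_def)
  have ns: "\<not> sim u v" "\<not> sim u y" "\<not> sim v x" "\<not> sim v y" "\<not> sim u x" "\<not> sim v u" "\<not> sim y u" "\<not> sim x v"
    using cross_not_sim w z t sim_sym by blast+
  show ?thesis
  proof (cases "sim x y")
    case True
    then have "cross t v y" using cross_sim[OF t(1), of v y] l sim_refl sim_sym by blast
    then show ?thesis using that w z by blast
  next
    case False
    have nyx: "\<not> sim y x" using False sim_sym by blast
    have zn: "\<not> E z v" "\<not> E z x" using cross_light_nbr[OF z(1)] l ns z(2) t(2) False sim_sym by blast+
    have tn: "\<not> E t u" "\<not> E t y" using cross_light_nbr[OF t(1)] l ns z(2) t(2) nyx sim_sym by blast+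
    have hv: "heavy t" "heavy z" using cross_heavy t z by blast+
    have Ezy: "E z u" "E z y" "E t v" "E t x" using z t by (auto simp: cross_def)
    have tz: "t \<noteq> z" using zn Ezy by blast
    have "z \<noteq> v" "z \<noteq> x" using hv l by (auto simp: light_def)
    then have "\<not> E t z" using cross_nbr[OF t(1), of z] zn by blast
    then have "d t + d z + 2 \<le> card V + card {c. E t c \<and> E z c}"
      using card_common_nbrs_nonadjacent[OF tz] heavy_V hv by blast
    then have "3 \<le> card {c. E t c \<and> E z c}" using hv by (auto simp: heavy_def)
    moreover have "\<exists>s. {c. E t c \<and> E z c} \<subseteq> {w, s}"
    proof -
      \<comment> \<open>By \<open>claw\<close> at \<open>t\<close> and at \<open>z\<close>,
        \<open>c\<close> sees \<open>v\<close> or \<open>x\<close> and also \<open>u\<close> or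
        \<open>y\<close>. The combinations v, y and u, x would give the class of \<open>v\<close> or
        of \<open>u\<close> a third partner.\<close>
      have "c = w \<or> cross c x y" if c: "E t c" "E z c" for c
      proof -
        have "c \<noteq> v" "c \<noteq> x" "c \<noteq> u" "c \<noteq> y" using c zn tn by blast+
        then have "E c v \<or> E c x" "E c u \<or> E c y" using cross_nbr[OF t(1), of c] cross_nbr[OF z(1), of c] c by blast+
        moreover have "c = w" if "E c u" "E c v" using cross_unique[OF crossI[of u v c] w] l ns that by blast
        moreover have False if "E c v" "E c y"
          using no_three_partners[OF cross_sym[OF w] t(1) crossI[of v y c]] l ns that t(2) False sim_sym by blast
        moreover have False if "E c x" "E c u"
          using no_three_partners[OF w z(1) crossI[of u x c]] l ns that z(2) nyx sim_sym by blast
        moreover have "cross c x y" if "E c x" "E c y" using crossI[of x y c] l False that by blast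
        ultimately show ?thesis by blast
      qed
      then show ?thesis using cross_unique by blast
    qed
    then obtain s where "{c. E t c \<and> E z c} \<subseteq> {w, s}" by blast
    then have "card {c. E t c \<and> E z c} \<le> card {w, s}" by (intro card_mono) auto
    then have "card {c. E t c \<and> E z c} \<le> 2" using card_length[of "[w, s]"] by simp
    ultimately show ?thesis by linarith
  qed
qed

text \<open>If \<open>x\<close> differs from \<open>w\<close>, uniqueness separates it from
  \<open>v\<close>; then \<open>P4\<close> joins it to \<open>w\<close>, and the claw at
  \<open>w\<close> joins it to the whole class of \<open>u\<close>. One cycle neighbour of
  \<open>w\<close> lies in that class, so \<open>x\<close> can be taken out between \<open>p\<close>
  and \<open>q\<close> and reinserted next to \<open>w\<close>.\<close>

lemma heavy_inside_class:
  assumes h: "ham xs" and w: "cross w u v" and x: "heavy x" "nxt xs p x" "nxt xs x q" "sim p u" "sim q u"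
  shows "x = w"
proof (rule ccontr)
  assume xw: "x \<noteq> w"
  have l: "light u" "light v" "light p" using w sim_light[OF x(4)] by (auto simp: cross_def)
  have Ex: "E x p" "E x q" using nxt_E[OF h x(2)] nxt_E[OF h x(3)] E_sym by blast+
  have "sim p q" using x sim_sym sim_trans by blast
  then have Epq: "E p q" using prev_neq_next[OF h x(2,3)] sim_E by blast
  have wp: "cross w p v" using cross_sim1[OF w x(4)] .
  have nv: "\<not> E x v"
  proof
    assume "E x v"
    then have "cross x p v" using Ex wp by (auto simp: cross_def)
    then show False using cross_unique wp xw by blast
  qed
  have Exw: "E x w" using cross_nbr_of_end[OF wp Ex(1) xw nv] .
  have hw: "heavy w" using cross_heavy[OF w] .
  have *: "E b x" if "sim b u" for b
  proof -
    have "cross w b v" using cross_sim1[OF w that] .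
    moreover have "x \<noteq> b" "x \<noteq> v" using x(1) that l by (auto simp: sim_def light_def)
    ultimately show ?thesis using cross_nbr[of w b v x] Exw nv E_sym by blast
  qed
  obtain a where a: "nxt xs a w" using prev_exists[OF h heavy_V[OF hw]] .
  obtain b where b: "nxt xs w b" using nxt_exists[OF h heavy_V[OF hw]] .
  have "sim a u \<or> sim b u" using cross_passes[OF h w a b] by blast
  then show False
    using no_insertion[OF h x(1-3) Epq hw _ b] no_insertion'[OF h x(1-3) Epq hw _ a] * Exw E_sym by blast
qed

text \<open>The crossings \<open>w\<close>, \<open>z\<close>, \<open>t\<close> form a triangle, and
  each class is a clique joined completely to two of them. So any part of a class, even none of it,
  can be placed between its two crossings.\<close>

theorem pancyclic_sun: "pancyclic V E"
proof -
  obtain u v y w z t where w: "cross w u v" and z: "cross z u y" and t: "cross t v y" using sun .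
  have l: "light u" "light v" "light y" using w z by (auto simp: cross_def)
  have ns: "\<not> sim u v" "\<not> sim u y" "\<not> sim v y" "\<not> sim v u" "\<not> sim y u" "\<not> sim y v"
    using cross_not_sim w z t sim_sym by blast+
  obtain xs where h: "ham xs" using ham_ex by blast
  have hv: "heavy w" "heavy z" "heavy t" using cross_heavy w z t by blast+
  \<comment> \<open>Otherwise a Hamilton cycle leaves the three classes across some crossing, and
    the class it comes from, which has the other two as partners, gains a third.\<close>
  have lights: "sim a u \<or> sim a v \<or> sim a y" if a: "light a" for a
  proof (rule ccontr)
    assume na: "\<not> ?thesis"
    define C where "C = {x. sim x u \<or> sim x v \<or> sim x y}"
    obtain p s q where s: "nxt xs p s" "nxt xs s q" "p \<in> C" "heavy s" "light q" "q \<notin> C"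
    proof (rule exit_light_class[OF h, of C u a])
      show "light x" if "x \<in> C" for x using that sim_light by (auto simp: C_def)
      show "b \<in> C" if "x \<in> C" "light b" "E x b" for x b
      proof -
        have "light x" using that(1) sim_light by (auto simp: C_def)
        then have "sim b x" using that(2) E_sym[OF that(3)] by (simp add: sim_def)
        then show ?thesis using that(1) sim_trans by (auto simp: C_def)
      qed
    qed (use l a na in \<open>auto simp: C_def sim_refl\<close>)
    have Es: "E s p" "E s q" using nxt_E[OF h s(1)] nxt_E[OF h s(2)] E_sym by blast+
    have nq: "\<not> sim u q" "\<not> sim v q" "\<not> sim y q" using s(6) sim_sym by (auto simp: C_def)
    have p: "sim p u \<or> sim p v \<or> sim p y" using s(3) by (simp add: C_def)
    then have "light p" "\<not> sim p q" using nq sim_light sim_trans sim_sym by blast+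
    then have c: "cross s p q" using crossI s(5) Es by blast
    have "cross s u q \<or> cross s v q \<or> cross s y q" using p cross_sim1[OF c] sim_sym by blast
    then show False
      using no_three_partners[OF w z, of s q] no_three_partners[OF cross_sym[OF w] t, of s q]
        no_three_partners[OF cross_sym[OF z] cross_sym[OF t], of s q] ns nq by blast
  qed
  have heavies: "x = w \<or> x = z \<or> x = t" if x: "heavy x" for x
  proof -
    obtain p where p: "nxt xs p x" using prev_exists[OF h heavy_V[OF x]] .
    obtain q where q: "nxt xs x q" using nxt_exists[OF h heavy_V[OF x]] .
    have lpq: "light p" "light q" using light_prev[OF h p x] light_nxt[OF h q x] .
    have E: "E x p" "E x q" using nxt_E[OF h p] nxt_E[OF h q] E_sym by blast+
    show ?thesis
    proof (cases "sim p q")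
      case True
      then have qp: "sim q p" using sim_sym by blast
      show ?thesis
        using lights[OF lpq(1)] heavy_inside_class[OF h w x p q] heavy_inside_class[OF h cross_sym[OF w] x p q]
          heavy_inside_class[OF h cross_sym[OF z] x p q] sim_trans[OF qp] by blast
    next
      case False
      have c: "cross x p q" "cross x q p" using crossI lpq False E cross_sym by blast+
      have c': "cross x a b" if "sim p a" "sim q b" for a b using cross_sim[OF c(1)] that sim_sym by blast
      have "cross x u v \<or> cross x u y \<or> cross x v y"
        using lights[OF lpq(1)] lights[OF lpq(2)] c' cross_sym False sim_sym sim_trans by meson
      then show ?thesis using cross_unique w z t by blast
    qed
  qed
  define cls where "cls a = {x. sim x a}" for a
  have clsV: "cls a \<subseteq> V" for a using sim_light light_V by (auto simp: cls_def)
  have fc: "finite (cls a)" for a using finite_subset[OF clsV fin] .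
  obtain us where us: "set us = cls u" "distinct us" using finite_distinct_list[OF fc] by blast
  obtain vs where vs: "set vs = cls v" "distinct vs" using finite_distinct_list[OF fc] by blast
  obtain ys where ys: "set ys = cls y" "distinct ys" using finite_distinct_list[OF fc] by blast
  have V: "V = {w, z, t} \<union> (cls u \<union> (cls v \<union> cls y))"
  proof
    show "V \<subseteq> {w, z, t} \<union> (cls u \<union> (cls v \<union> cls y))"
      using lights heavies by (auto simp: cls_def light_def)
    show "{w, z, t} \<union> (cls u \<union> (cls v \<union> cls y)) \<subseteq> V" using clsV hv heavy_V by blast
  qed
  have disj: "cls a \<inter> cls b = {}" if "\<not> sim a b" for a b
  proof -
    have "\<not> (sim x a \<and> sim x b)" for x using that sim_sym sim_trans by blast
    then show ?thesis by (auto simp: cls_def)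
  qed
  have lcls: "w \<notin> cls a" "z \<notin> cls a" "t \<notin> cls a" for a using hv by (auto simp: cls_def sim_def light_def)
  have wzt: "E w z" "E z t" "E t w"
    using cross_adjacent[OF w z ns(3)] cross_adjacent[OF cross_sym[OF z] cross_sym[OF t] ns(1)]
      cross_adjacent[OF t cross_sym[OF w] ns(5)] by blast+
  have neq: "w \<noteq> z" "z \<noteq> t" "w \<noteq> t" using wzt E_neq by blast+
  have "card (cls u \<union> (cls v \<union> cls y)) = length us + (length vs + length ys)"
    using us vs ys fc disj ns by (simp add: card_Un_disjoint Int_Un_distrib flip: distinct_card)
  moreover have "card V = card {w, z, t} + card (cls u \<union> (cls v \<union> cls y))"
    unfolding V by (rule card_Un_disjoint) (use fc lcls in auto)
  ultimately have n: "card V = 3 + (length us + (length vs + length ys))" using neq by simp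
  have clique: "successively E as" if "distinct as" "set as \<subseteq> cls a" for as a
    unfolding successively_conv_nth
  proof (intro allI impI)
    fix i assume i: "Suc i < length as"
    then have "as ! i \<noteq> as ! Suc i" "as ! i \<in> cls a" "as ! Suc i \<in> cls a"
      using that by (auto simp: nth_eq_iff_index_eq)
    then have "sim (as ! i) (as ! Suc i)" using sim_sym sim_trans unfolding cls_def by blast
    then show "E (as ! i) (as ! Suc i)" using sim_E \<open>as ! i \<noteq> as ! Suc i\<close> by blast
  qed
  have adj: "E w x" "E z x" "E x w" "E x z" if "x \<in> cls u" for x
    using cross_sim1[OF w, of x] cross_sim1[OF z, of x] that E_sym by (auto simp: cls_def cross_def)
  have adj2: "E w x" "E t x" "E x w" "E x t" if "x \<in> cls v" for x
    using cross_sim1[OF cross_sym[OF w], of x] cross_sim1[OF t, of x] that E_sym by (auto simp: cls_def cross_def)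
  have adj3: "E z x" "E t x" "E x z" "E x t" if "x \<in> cls y" for x
    using cross_sim1[OF cross_sym[OF z], of x] cross_sym[OF cross_sim1[OF cross_sym[OF t], of x]] that E_sym
    by (auto simp: cls_def cross_def)
  show ?thesis
    unfolding pancyclic_def
  proof (intro allI impI)
    fix k assume k: "3 \<le> k \<and> k \<le> card V"
    \<comment> \<open>The k - 3 vertices besides \<open>w\<close>, \<open>z\<close>,
      \<open>t\<close> are taken greedily from the three classes in turn.\<close>
    define A where "A = take (k - 3) us"
    define B where "B = take (k - 3 - length A) ys"
    define C where "C = take (k - 3 - length A - length B) vs"
    have len: "length A + length B + length C = k - 3" using k n by (auto simp: A_def B_def C_def)
    have sA: "set A \<subseteq> cls u" "distinct A" using us by (auto simp: A_def dest: in_set_takeD)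
    have sB: "set B \<subseteq> cls y" "distinct B" using ys by (auto simp: B_def dest: in_set_takeD)
    have sC: "set C \<subseteq> cls v" "distinct C" using vs by (auto simp: C_def dest: in_set_takeD)
    have ends: "A \<noteq> [] \<Longrightarrow> E w (hd A) \<and> E (last A) z" "B \<noteq> [] \<Longrightarrow> E z (hd B) \<and> E (last B) t"
      "C \<noteq> [] \<Longrightarrow> E t (hd C) \<and> E (last C) w"
      using adj(1)[of "hd A"] adj(4)[of "last A"] sA(1) hd_in_set[of A] last_in_set[of A]
        adj3(1)[of "hd B"] adj3(4)[of "last B"] sB(1) hd_in_set[of B] last_in_set[of B]
        adj2(2)[of "hd C"] adj2(3)[of "last C"] sC(1) hd_in_set[of C] last_in_set[of C]
      by blast+
    have dj: "set A \<inter> set B = {}" "set A \<inter> set C = {}" "set B \<inter> set C = {}"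
      using sA sB sC disj[OF ns(1)] disj[OF ns(2)] disj[OF ns(6)] by blast+
    have mem: "w \<notin> set A" "w \<notin> set B" "w \<notin> set C" "z \<notin> set A" "z \<notin> set B" "z \<notin> set C"
      "t \<notin> set A" "t \<notin> set B" "t \<notin> set C" using sA sB sC lcls by blast+
    have "is_cycle V E (w # A @ z # B @ t # C)"
      unfolding is_cycle_iff
    proof (intro conjI)
      show "set (w # A @ z # B @ t # C) \<subseteq> V" using sA sB sC V by auto
      show "distinct (w # A @ z # B @ t # C)" using sA sB sC dj mem neq by auto
      show "successively E (w # A @ z # B @ t # C)"
        using clique[OF sA(2,1)] clique[OF sB(2,1)] clique[OF sC(2,1)] ends wzt
        by (auto simp: successively_append_iff successively_Cons hd_append)
      show "E (last (w # A @ z # B @ t # C)) (hd (w # A @ z # B @ t # C))"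
        using ends wzt by auto
    qed simp
    moreover have "length (w # A @ z # B @ t # C) = 3 + (length A + length B + length C)" by simp
    then have "length (w # A @ z # B @ t # C) = k" using len k by linarith
    ultimately show "\<exists>xs. is_cycle V E xs \<and> length xs = k" by blast
  qed
qed

end

section \<open>Heavy subgraphs\<close>

context sgraph
begin

lemma dist_is_2:
  assumes "E a c" "E c b" "a \<noteq> b" "\<not> E a b" "{a, b, c} \<subseteq> S"
  shows "dist_is S E a b 2"
  unfolding dist_is_def path_in_def walk_in_iff
proof (intro conjI allI impI)
  show "\<exists>xs. (xs \<noteq> [] \<and> set xs \<subseteq> S \<and> successively E xs) \<and> distinct xs \<and> hd xs = a \<and> last xs = b \<and> length xs = Suc 2"
    using assms by (intro exI[of _ "[a, c, b]"]) (auto dest: E_neq)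
  fix j :: nat assume "j < 2"
  then have j: "j = 0 \<or> j = 1" by linarith
  show "\<not> (\<exists>xs. (xs \<noteq> [] \<and> set xs \<subseteq> S \<and> successively E xs) \<and> distinct xs \<and> hd xs = a \<and> last xs = b \<and> length xs = Suc j)"
  proof
    assume "\<exists>xs. (xs \<noteq> [] \<and> set xs \<subseteq> S \<and> successively E xs) \<and> distinct xs \<and> hd xs = a \<and> last xs = b \<and> length xs = Suc j"
    then show False using j assms by (auto simp: length_Suc_conv)
  qed
qed

lemma heavy_of_dist_2:
  assumes "R_f1_heavy V E RV RE" "induced_iso V E S RV RE"
    and "E a c" "E c b" "a \<noteq> b" "\<not> E a b" "{a, b, c} \<subseteq> S"
  shows "heavy a \<or> heavy b"
proof -
  define m where "m = max (d a) (d b)"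
  have "(real (card V) + 1) / 2 \<le> real m"
    using assms(1,2,7) dist_is_2[OF assms(3-7)] unfolding R_f1_heavy_def f1_heavy_set_def m_def by blast
  then have "real (card V + 1) \<le> real (2 * m)" by simp
  then have "card V + 1 \<le> 2 * m" by (simp only: of_nat_le_iff)
  then show ?thesis using E_V[OF assms(3)] E_V[OF assms(4)] by (auto simp: heavy_def m_def max_def split: if_splits)
qed

lemma induced_claw:
  assumes "E c a" "E c b" "E c e" "a \<noteq> b" "a \<noteq> e" "b \<noteq> e" "\<not> E a b" "\<not> E a e" "\<not> E b e"
  shows "induced_iso V E {c, a, b, e} claw_V claw_E"
proof -
  define f where "f i = (if i = 0 then c else if i = 1 then a else if i = 2 then b else e)" for i :: nat
  have n: "c \<noteq> a" "c \<noteq> b" "c \<noteq> e" "\<not> E b a" "\<not> E e a" "\<not> E e b" "E a c" "E b c" "E e c"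
    using assms E_neq E_sym by blast+
  have "bij_betw f claw_V {c, a, b, e}"
    using assms(4-6) n by (auto simp: bij_betw_def inj_on_def claw_V_def f_def)
  moreover have "\<forall>i\<in>claw_V. \<forall>j\<in>claw_V. E (f i) (f j) \<longleftrightarrow> claw_E i j"
    using assms n by (simp add: claw_E_def claw_V_def f_def)
  moreover have "{c, a, b, e} \<subseteq> V" using assms(1-3) E_V by blast
  ultimately show ?thesis unfolding induced_iso_def by blast
qed

lemma induced_P4:
  assumes "E p q" "E q r" "E r s" "p \<noteq> r" "p \<noteq> s" "q \<noteq> s" "\<not> E p r" "\<not> E p s" "\<not> E q s"
  shows "induced_iso V E {p, q, r, s} P4_V P4_E"
proof -
  define f where "f i = (if i = 0 then p else if i = 1 then q else if i = 2 then r else s)" for i :: nat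
  have n: "p \<noteq> q" "q \<noteq> r" "r \<noteq> s" "\<not> E r p" "\<not> E s p" "\<not> E s q" "E q p" "E r q" "E s r"
    using assms E_neq E_sym by blast+
  have "bij_betw f P4_V {p, q, r, s}"
    using assms(4-6) n by (auto simp: bij_betw_def inj_on_def P4_V_def f_def)
  moreover have "\<forall>i\<in>P4_V. \<forall>j\<in>P4_V. E (f i) (f j) \<longleftrightarrow> P4_E i j"
    using assms n by (simp add: P4_E_def P4_V_def f_def)
  moreover have "{p, q, r, s} \<subseteq> V" using assms(1-3) E_V by blast
  ultimately show ?thesis unfolding induced_iso_def by blast
qed

end

theorem theorem7:
  fixes V :: "'a set" and E :: "'a \<Rightarrow> 'a \<Rightarrow> bool"
  assumes "graph V E"
    and "two_connected V E"
    and "\<not> is_cycle_graph V E"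
    and "R_f1_heavy V E claw_V claw_E"
    and "R_f1_heavy V E P4_V P4_E"
  shows "pancyclic V E"
proof (rule ccontr)
  assume np: "\<not> pancyclic V E"
  interpret sgraph V E
    using assms(1) by unfold_locales (auto simp: graph_def)
  interpret heavy_graph V E
  proof
    fix c a b e
    assume a: "E c a" "E c b" "E c e" "a \<noteq> b" "a \<noteq> e" "b \<noteq> e" "\<not> E a b" "\<not> E a e" "\<not> E b e"
      "\<not> heavy a" "\<not> heavy b"
    show False
      using heavy_of_dist_2[OF assms(4) induced_claw[OF a(1-9)] E_sym[OF a(1)] a(2,4,7)] a(10,11) by blast
  next
    fix p q r s
    assume a: "E p q" "E q r" "E r s" "p \<noteq> r" "p \<noteq> s" "q \<noteq> s" "\<not> E p r" "\<not> E p s" "\<not> E q s"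
      "\<not> heavy p" "\<not> heavy r"
    show False
      using heavy_of_dist_2[OF assms(5) induced_P4[OF a(1-9)] a(1,2,4,7)] a(10,11) by blast
  qed
  interpret stuck_graph V E
  proof
    show "\<exists>xs. ham xs" using hamiltonian[OF assms(2)] unfolding ham_def by metis
    fix x y zs assume h: "ham (x # y # zs)"
    \<comment> \<open>Rotation turns the edge x y into the closing edge, the form that
      \<open>pancyclic_if_large_degree_sum\<close> expects.\<close>
    then have "is_cycle V E (y # zs @ [x])" using is_cycle_rotate1 by (fastforce simp: ham_def)
    moreover have "length (y # zs @ [x]) = card V" using ham_length[OF h] by simp
    ultimately have "\<not> card V + 1 \<le> d y + d x" using pancyclic_if_large_degree_sum np by blast
    then show "d x + d y \<le> card V" by linarith
  qed
  interpret far_stuck_graph V E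
  proof
    fix w u v assume "cross w u v"
    then show "\<exists>y\<in>V. y \<noteq> u \<and> y \<noteq> v \<and> \<not> E y u \<and> \<not> E y v"
      using dominated_pair_cycle_graph assms(3) by blast
  qed
  show False using pancyclic_sun np by blast
qed

end
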